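(* Let $p=p_n$ be positive integers with $n>p\ge 1$ for each $n\ge 2$, and assume there exist constants $h_1,h_2\in(0,1)$ such that $h_1<\frac{p}{n}<h_2$ for all $n\ge 2$. For each $n\geq 2$ let $(z_1,\dots,z_p)$ be a random vector in $\{z\in\mathbb{C}:|z|<1\}^p$ with joint probability density function (with respect to Lebesgue measure) $$C\cdot\prod_{1\le j<k\le p}|z_j-z_k|^2\prod_{j=1}^{p}(1-|z_j|^2)^{n-p-1},$$ where $C$ is a normalizing constant. For $y>3$ set $$a(y)=(\log y)^{1/2}-(\log y)^{-1/2}\log(\sqrt{2\pi}\,\log y),\qquad b(y)=(\log y)^{-1/2},$$ and define (for all large $n$) $$c_n=\Big(\frac{p-1}{n-1}\Big)^{1/2},\quad a_n=a\Big(\frac{nc_n^2}{1-c_n^2}\Big),\quad b_n=b\Big(\frac{nc_n^2}{1-c_n^2}\Big),$$ $$A_n=c_n+\tfrac12(1-c_n^2)^{1/2}(n-1)^{-1/2}a_n,\qquad B_n=\tfrac12(1-c_n^2)^{1/2}(n-1)^{-1/2}b_n.$$ Then, as $n\to\infty$, $\big(\max_{1\le j\le p}|z_j|-A_n\big)/B_n$ converges weakly to the cdf $\Lambda(x)=\exp(-e^{-x})$, $x\in\mathbb{R}$.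
   Context: "$X_n$ converges weakly to the cdf $F$" means that the probability distribution of $X_n$ converges weakly to the probability distribution with cumulative distribution function $F$. The density above is the joint density of the eigenvalues of the top-left $p\times p$ submatrix $\mathbf{A}$ of an $n\times n$ Haar-distributed unitary matrix. *)

theory Defs
  imports "HOL-Probability.Probability"
begin

text \<open>The probability distribution with cdf \<open>F\<close> is the unique Borel probability measure
  \<open>N\<close> on the reals with \<open>cdf N = F\<close>; its existence is part of the assertion. The
  variables \<open>X n\<close> may live on different probability spaces \<open>M n\<close>.\<close>

definition converges_weakly_to_cdf ::
  "(nat \<Rightarrow> 'a measure) \<Rightarrow> (nat \<Rightarrow> 'a \<Rightarrow> real) \<Rightarrow> (real \<Rightarrow> real) \<Rightarrow> bool" where
  "converges_weakly_to_cdf M X F \<longleftrightarrow>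
     (\<exists>N. real_distribution N \<and> cdf N = F \<and>
          weak_conv_m (\<lambda>n. distr (M n) borel (X n)) N)"

definition gumbel_cdf :: "real \<Rightarrow> real" where
  "gumbel_cdf x = exp (- exp (- x))"

text \<open>The eigenvalue density, up to the constant \<open>C\<close>, of the top-left \<open>p \<times> p\<close> block of an
  \<open>n \<times> n\<close> Haar unitary matrix (\<open>p < n\<close>, so that the exponent is not truncated), extended by zero
  outside the \<open>p\<close>-fold product of open unit discs. Components are indexed by \<open>1..p\<close>.\<close>

definition truncated_unitary_density ::
  "nat \<Rightarrow> nat \<Rightarrow> real \<Rightarrow> (nat \<Rightarrow> complex) \<Rightarrow> real" where
  "truncated_unitary_density n p C z =
     (if \<forall>j\<in>{1..p}. cmod (z j) < 1
      then C * (\<Prod>(j, k)\<in>{(j, k). 1 \<le> j \<and> j < k \<and> k \<le> p}. (cmod (z j - z k))\<^sup>2)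
             * (\<Prod>j=1..p. (1 - (cmod (z j))\<^sup>2) ^ (n - p - 1))
      else 0)"

text \<open>The norming functions \<open>norm_a\<close> and \<open>norm_b\<close> are meant for arguments greater than 3, where
  the logarithm is positive; elsewhere their values are irrelevant.\<close>

definition norm_a :: "real \<Rightarrow> real" where
  "norm_a y = ln y powr (1/2) - ln y powr (-1/2) * ln (sqrt (2 * pi) * ln y)"

definition norm_b :: "real \<Rightarrow> real" where
  "norm_b y = ln y powr (-1/2)"

definition c_seq :: "(nat \<Rightarrow> nat) \<Rightarrow> nat \<Rightarrow> real" where
  "c_seq p n = sqrt ((real (p n) - 1) / (real n - 1))"

definition a_seq :: "(nat \<Rightarrow> nat) \<Rightarrow> nat \<Rightarrow> real" where
  "a_seq p n = norm_a (real n * (c_seq p n)\<^sup>2 / (1 - (c_seq p n)\<^sup>2))"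

definition b_seq :: "(nat \<Rightarrow> nat) \<Rightarrow> nat \<Rightarrow> real" where
  "b_seq p n = norm_b (real n * (c_seq p n)\<^sup>2 / (1 - (c_seq p n)\<^sup>2))"

definition A_seq :: "(nat \<Rightarrow> nat) \<Rightarrow> nat \<Rightarrow> real" where
  "A_seq p n = c_seq p n +
     1/2 * sqrt (1 - (c_seq p n)\<^sup>2) * (real n - 1) powr (-1/2) * a_seq p n"

definition B_seq :: "(nat \<Rightarrow> nat) \<Rightarrow> nat \<Rightarrow> real" where
  "B_seq p n = 1/2 * sqrt (1 - (c_seq p n)\<^sup>2) * (real n - 1) powr (-1/2) * b_seq p n"

end

theory Submission
  imports Defs "Jordan_Normal_Form.Determinant" "HOL-Real_Asymp.Real_Asymp"
begin

text \<open>Expanding the squared Vandermonde determinant and using that the monomials are orthogonal for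
  every rotation invariant weight, the probability that all moduli are at most \<open>x\<close> factorises into
  \<open>\<Prod>k<p. P(Beta(k + 1, n - p) \<le> x\<^sup>2)\<close>. The complementary probabilities are negative
  binomial distribution functions with success parameter \<open>1 - x\<^sup>2\<close>; summing them over \<open>k\<close> gives
  \<open>\<Sum>m<p. (m + 1) * w (p - 1 - m)\<close> with negative binomial weights \<open>w\<close>. For
  \<open>x = A\<^sub>n + B\<^sub>n t\<close> the weights decay almost geometrically as \<open>m\<close> grows, with ratio
  \<open>1 - \<delta>\<close>, \<open>\<delta>\<close> of order \<open>sqrt (log n / n)\<close>, so the sum is asymptotic to \<open>w (p - 1) / \<delta>\<^sup>2\<close>,
  which tends to \<open>exp (- t)\<close> by Stirling's formula. The largest summand is at most \<open>w (p - 1) / \<delta>\<close>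
  and hence negligible, so the product tends to \<open>exp (- exp (- t))\<close>.\<close>

text \<open>The obstacle is precision: \<open>w (p - 1)\<close> is of order log n / n, outside the
  range of a central limit theorem, and its leading term is needed exactly. Its exponent is - s^2 /
  2 with s of order sqrt (log n), up to a cubic remainder of order s^3 / sqrt n, which vanishes;
  this is why second-order expansions are enough. As \<delta> is asymptotic to s / sqrt Y with Y of
  order n, the quantity to be tuned is sqrt Y * exp (- s^2 / 2) / (sqrt (2 pi) * s^2), and
  \<open>norm_a\<close> and \<open>norm_b\<close> form an asymptotic solution of the equation that
  it be exp (- t). The ratio p / n is confined to a compact part of (0, 1) but need not converge, so
  the limits are arranged such that it enters only through bounded factors. Passing from beta to
  negative binomial variables replaces integral estimates by ratios of consecutive weights. These
  are explicit and monotone, so geometric comparison works in both directions.\<close>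

section \<open>The Vandermonde determinant\<close>

text \<open>Induction with the last node replaced by a variable x: the determinant is then a
  polynomial in x of degree at most n, its coefficient at \<open>x ^ n\<close> is the smaller
  determinant, and it vanishes at every earlier node.\<close>

lemma det_vandermonde:
  fixes z :: "nat \<Rightarrow> 'a::field"
  shows "Determinant.det (Matrix.mat n n (\<lambda>(i, j). z i ^ j)) = (\<Prod>j<n. \<Prod>i<j. z j - z i)"
proof (induction n)
  case 0
  then show ?case by (simp add: Determinant.det_def)
next
  case (Suc n)
  define A where "A x = Matrix.mat (Suc n) (Suc n) (\<lambda>(i, j). (z(n := x)) i ^ j)" for x
  have A: "A x \<in> carrier_mat (Suc n) (Suc n)" for x by (simp add: A_def)
  define cf where "cf j = cofactor (A 0) n j" for j
  have del: "mat_delete (A x) n j = mat_delete (A 0) n j" for x j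
    by (rule eq_matI) (auto simp: mat_delete_def A_def)
  have cof: "cofactor (A x) n j = cf j" for x j
    unfolding cf_def cofactor_def del[of x j] ..
  have detA: "Determinant.det (A x) = (\<Sum>j\<le>n. x ^ j * cf j)" for x
  proof -
    have "Determinant.det (A x) = (\<Sum>j<Suc n. A x $$ (n, j) * cofactor (A x) n j)"
      by (rule laplace_expansion_row[OF A]) simp
    also have "\<dots> = (\<Sum>j<Suc n. x ^ j * cf j)"
      by (intro sum.cong refl, simp only: cof) (simp add: A_def)
    finally show ?thesis by (simp add: lessThan_Suc_atMost)
  qed
  have lead: "cf n = (\<Prod>j<n. \<Prod>i<j. z j - z i)"
  proof -
    have "mat_delete (A 0) n n = Matrix.mat n n (\<lambda>(i, j). z i ^ j)"
      by (rule eq_matI) (auto simp: mat_delete_def A_def)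
    then show ?thesis unfolding cf_def cofactor_def by (simp add: Suc.IH)
  qed
  have root: "Determinant.det (A (z i)) = 0" if "i < n" for i
  proof (rule det_identical_rows[OF A, of i n])
    show "row (A (z i)) i = row (A (z i)) n"
      using that by (intro eq_vecI) (auto simp: A_def)
  qed (use that in auto)
  have "Determinant.det (A (z n)) = cf n * (\<Prod>i<n. z n - z i)"
  \<comment> \<open>Counting roots needs n distinct earlier nodes. If two of them coincide, both
    sides vanish.\<close>
  proof (cases "inj_on z {..<n}")
    case True
    \<comment> \<open>The terms of degree n cancel in \<open>q\<close>, which still vanishes at the
      n distinct nodes; so \<open>q\<close> can only be 0.\<close>
    define q where "q = (\<Sum>j\<le>n. Polynomial.monom (cf j) j) - Polynomial.smult (cf n) (\<Prod>i<n. [:- z i, 1:])"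
    have pq: "poly q x = Determinant.det (A x) - cf n * (\<Prod>i<n. x - z i)" for x
      by (simp add: q_def detA poly_sum poly_monom poly_prod mult.commute)
    have degp: "Polynomial.degree (\<Prod>i<n. [:- z i, 1:]) = n"
      by (subst degree_prod_eq_sum_degree) auto
    have "q = 0"
    proof (rule ccontr)
      assume "q \<noteq> 0"
      have le: "Polynomial.degree q \<le> n"
        unfolding q_def
        by (intro degree_diff_le degree_sum_le)
           (auto intro: order.trans[OF degree_monom_le] order.trans[OF degree_smult_le] simp: degp)
      have "lead_coeff (\<Prod>i<n. [:- z i, 1:]) = 1"
        by (subst lead_coeff_prod) simp
      then have "Polynomial.coeff (\<Prod>i<n. [:- z i, 1:]) n = 1" using degp by simp
      then have "Polynomial.coeff q n = 0"
        by (simp add: q_def coeff_sum coeff_monom)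
      then have "Polynomial.degree q < n \<or> n = 0"
        using le \<open>q \<noteq> 0\<close> by (metis leading_coeff_0_iff le_neq_implies_less)
      moreover have "z ` {..<n} \<subseteq> {x. poly q x = 0}"
        by (auto simp: pq root)
      then have "card (z ` {..<n}) \<le> card {x. poly q x = 0}"
        using poly_roots_finite[OF \<open>q \<noteq> 0\<close>] card_mono by blast
      then have "n \<le> Polynomial.degree q"
        using card_image[OF True] card_poly_roots_bound[OF \<open>q \<noteq> 0\<close>] by simp
      ultimately have "n = 0" by simp
      with \<open>Polynomial.coeff q n = 0\<close> le \<open>q \<noteq> 0\<close> show False
        by (metis le_zero_eq leading_coeff_0_iff)
    qed
    then show ?thesis using pq[of "z n"] by simp
  next
    case False
    then obtain i k where ik: "i < k" "k < n" "z i = z k"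
      by (auto simp: inj_on_def) (metis linorder_neqE_nat)
    have "Determinant.det (A (z n)) = 0"
    proof (rule det_identical_rows[OF A, of i k])
      show "row (A (z n)) i = row (A (z n)) k"
        using ik by (intro eq_vecI) (auto simp: A_def)
    qed (use ik in auto)
    moreover have "(\<Prod>i'<k. z k - z i') = 0"
      using ik by (intro prod_zero bexI[of _ i]) auto
    then have "(\<Prod>j<n. \<Prod>i<j. z j - z i) = 0"
      using ik by (intro prod_zero) auto
    ultimately show ?thesis by (simp add: lead)
  qed
  moreover have "A (z n) = Matrix.mat (Suc n) (Suc n) (\<lambda>(i, j). z i ^ j)"
    by (simp add: A_def)
  ultimately show ?case by (simp add: lead)
qed

text \<open>Each summand is a product of functions of a single variable, the form to which Fubini
  and the orthogonality of monomials apply.\<close>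

lemma vandermonde_leibniz:
  fixes z :: "nat \<Rightarrow> 'a::field"
  shows "(\<Prod>j<n. \<Prod>i<j. z j - z i) =
    (\<Sum>\<sigma> | \<sigma> permutes {..<n}. of_int (sign \<sigma>) * (\<Prod>i<n. z i ^ \<sigma> i))"
proof -
  have "(\<Prod>i = 0..<n. Matrix.mat n n (\<lambda>(i, j). z i ^ j) $$ (i, \<sigma> i)) = (\<Prod>i = 0..<n. z i ^ \<sigma> i)"
    if "\<sigma> permutes {0..<n}" for \<sigma>
    using permutes_in_image[OF that] by (intro prod.cong) auto
  then show ?thesis
    unfolding det_vandermonde[symmetric] det_def'[OF mat_carrier]
    by (simp add: atLeast0LessThan)
qed

section \<open>Rotation invariance of planar Lebesgue measure\<close>

text \<open>Gives access to Fubini in the real and imaginary parts: a shear is then a translation of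
  one coordinate by an amount that depends only on the other.\<close>

lemma lborel_complex_eq_distr_pair:
  "(lborel :: complex measure) = distr (lborel \<Otimes>\<^sub>M lborel) borel (\<lambda>(x, y). Complex x y)"
proof (rule lborel_eqI)
  have meas: "(\<lambda>(x, y). Complex x y) \<in> borel_measurable (lborel \<Otimes>\<^sub>M lborel)"
  proof -
    have "(\<lambda>z::real \<times> real. complex_of_real (fst z) + \<i> * complex_of_real (snd z))
        \<in> borel_measurable (lborel \<Otimes>\<^sub>M lborel)"
      by measurable
    then show ?thesis by (simp add: Complex_eq case_prod_beta)
  qed
  fix l u :: complex
  assume lu: "\<And>b. b \<in> Basis \<Longrightarrow> l \<bullet> b \<le> u \<bullet> b"
  then have le: "Re l \<le> Re u" "Im l \<le> Im u"
    using lu[of 1] lu[of \<i>] by (auto simp: Basis_complex_def)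
  have "(\<lambda>(x, y). Complex x y) -` box l u \<inter> space (lborel \<Otimes>\<^sub>M lborel)
      = {Re l<..<Re u} \<times> {Im l<..<Im u}"
    by (auto simp: box_def Basis_complex_def space_pair_measure)
  then have "emeasure (distr (lborel \<Otimes>\<^sub>M lborel) borel (\<lambda>(x, y). Complex x y)) (box l u)
      = emeasure (lborel \<Otimes>\<^sub>M lborel) ({Re l<..<Re u} \<times> {Im l<..<Im u})"
    using meas by (subst emeasure_distr) (auto simp: borel_open)
  also have "\<dots> = ennreal (Re u - Re l) * ennreal (Im u - Im l)"
    using le by (subst lborel.emeasure_pair_measure_Times) auto
  also have "\<dots> = ennreal (\<Prod>b\<in>Basis. (u - l) \<bullet> b)"
    using le by (simp add: Basis_complex_def ennreal_mult)
  finally show "emeasure (distr (lborel \<Otimes>\<^sub>M lborel) borel (\<lambda>(x, y). Complex x y)) (box l u)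
      = ennreal (\<Prod>b\<in>Basis. (u - l) \<bullet> b)" .
qed simp

lemma nn_integral_lborel_complex:
  assumes [measurable]: "f \<in> borel_measurable borel"
  shows "(\<integral>\<^sup>+ z. f z \<partial>lborel) = (\<integral>\<^sup>+ y. \<integral>\<^sup>+ x. f (complex_of_real x + \<i> * complex_of_real y) \<partial>lborel \<partial>lborel)"
proof -
  have m: "(\<lambda>(x, y). Complex x y) = (\<lambda>z::real \<times> real. complex_of_real (fst z) + \<i> * complex_of_real (snd z))"
    by (auto simp: Complex_eq)
  have "(\<integral>\<^sup>+ z. f z \<partial>lborel) = (\<integral>\<^sup>+ z. f (complex_of_real (fst z) + \<i> * complex_of_real (snd z)) \<partial>(lborel \<Otimes>\<^sub>M lborel))"
    unfolding lborel_complex_eq_distr_pair m by (subst nn_integral_distr) auto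
  also have "\<dots> = (\<integral>\<^sup>+ y. \<integral>\<^sup>+ x. f (complex_of_real x + \<i> * complex_of_real y) \<partial>lborel \<partial>lborel)"
    by (subst lborel_pair.nn_integral_snd[symmetric]) (auto simp: case_prod_beta)
  finally show ?thesis .
qed

lemma nn_integral_lborel_complex':
  assumes [measurable]: "f \<in> borel_measurable borel"
  shows "(\<integral>\<^sup>+ z. f z \<partial>lborel) = (\<integral>\<^sup>+ x. \<integral>\<^sup>+ y. f (complex_of_real x + \<i> * complex_of_real y) \<partial>lborel \<partial>lborel)"
  unfolding nn_integral_lborel_complex[OF assms]
  by (rule lborel_pair.Fubini') measurable

lemma nn_integral_shear_Re:
  assumes [measurable]: "f \<in> borel_measurable borel"
  shows "(\<integral>\<^sup>+ z. f (z + complex_of_real (t * Im z)) \<partial>lborel) = (\<integral>\<^sup>+ z. f z \<partial>(lborel :: complex measure))"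
proof -
  have "(\<integral>\<^sup>+ x. f (complex_of_real x + \<i> * complex_of_real y + complex_of_real (t * y)) \<partial>lborel)
      = (\<integral>\<^sup>+ x. f (complex_of_real x + \<i> * complex_of_real y) \<partial>lborel)" for y
    by (subst nn_integral_real_affine[where c = 1 and t = "t * y", of "\<lambda>x. f (complex_of_real x + \<i> * complex_of_real y)"])
       (auto simp: algebra_simps)
  then show ?thesis
    by (subst (1 2) nn_integral_lborel_complex) auto
qed

lemma nn_integral_shear_Im:
  assumes [measurable]: "f \<in> borel_measurable borel"
  shows "(\<integral>\<^sup>+ z. f (z + \<i> * complex_of_real (t * Re z)) \<partial>lborel) = (\<integral>\<^sup>+ z. f z \<partial>(lborel :: complex measure))"
proof -
  have "(\<integral>\<^sup>+ y. f (complex_of_real x + \<i> * complex_of_real y + \<i> * complex_of_real (t * x)) \<partial>lborel)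
      = (\<integral>\<^sup>+ y. f (complex_of_real x + \<i> * complex_of_real y) \<partial>lborel)" for x
    by (subst nn_integral_real_affine[where c = 1 and t = "t * x", of "\<lambda>y. f (complex_of_real x + \<i> * complex_of_real y)"])
       (auto simp: algebra_simps)
  then show ?thesis
    by (subst (1 2) nn_integral_lborel_complex') auto
qed

text \<open>A rotation is a product of three shears.\<close>

lemma nn_integral_rotate:
  fixes w :: complex
  assumes [measurable]: "f \<in> borel_measurable borel" and w: "cmod w = 1" "Im w \<noteq> 0"
  shows "(\<integral>\<^sup>+ z. f (w * z) \<partial>lborel) = (\<integral>\<^sup>+ z. f z \<partial>lborel)"
proof -
  \<comment> \<open>For w = cis \<theta> this is - tan (\<theta> / 2), the coefficient of the two
    outer shears; the inner one has coefficient sin \<theta>.\<close>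
  define t where "t = (Re w - 1) / Im w"
  have sq: "(Re w)\<^sup>2 + (Im w)\<^sup>2 = 1"
    using w(1) by (simp add: cmod_def)
  define S where "S z = z + complex_of_real (t * Im z)" for z
  define T where "T z = z + \<i> * complex_of_real (Im w * Re z)" for z
  have [measurable]: "S \<in> borel_measurable borel" "T \<in> borel_measurable borel"
    unfolding S_def T_def by measurable
  have tw: "t * Im w = Re w - 1" using w(2) by (simp add: t_def)
  have "S (T (S z)) = w * z" for z
  proof (rule complex_eqI)
    have 1: "t * (Re w + 1) = - Im w"
      using sq w(2) by (simp add: t_def field_simps power2_eq_square)
    have "Re (S (T (S z))) = Re z * (1 + t * Im w) + Im z * (t + t * (1 + t * Im w))"
      by (simp add: S_def T_def algebra_simps)
    also have "\<dots> = Re z * Re w + Im z * (t * (Re w + 1))"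
      by (simp add: tw algebra_simps)
    finally show "Re (S (T (S z))) = Re (w * z)" unfolding 1 by simp
    have "Im (S (T (S z))) = Im z * (1 + t * Im w) + Im w * Re z"
      by (simp add: S_def T_def algebra_simps)
    then show "Im (S (T (S z))) = Im (w * z)" by (simp add: tw algebra_simps)
  qed
  then have "(\<integral>\<^sup>+ z. f (w * z) \<partial>lborel) = (\<integral>\<^sup>+ z. f (S (T (S z))) \<partial>lborel)" by simp
  also have "\<dots> = (\<integral>\<^sup>+ z. f (S (T z)) \<partial>lborel)"
    by (subst (2) S_def) (rule nn_integral_shear_Re, measurable)
  also have "\<dots> = (\<integral>\<^sup>+ z. f (S z) \<partial>lborel)"
    unfolding T_def by (rule nn_integral_shear_Im) measurable
  also have "\<dots> = (\<integral>\<^sup>+ z. f z \<partial>lborel)"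
    unfolding S_def by (rule nn_integral_shear_Re) measurable
  finally show ?thesis .
qed

lemma lborel_distr_rotate:
  fixes w :: complex
  assumes w: "cmod w = 1" "Im w \<noteq> 0"
  shows "distr lborel borel (\<lambda>z. w * z) = lborel"
proof (rule measure_eqI)
  fix A :: "complex set" assume "A \<in> sets (distr lborel borel (\<lambda>z. w * z))"
  then have [measurable]: "A \<in> sets borel" by simp
  have "emeasure (distr lborel borel (\<lambda>z. w * z)) A = (\<integral>\<^sup>+ z. indicator A z \<partial>distr lborel borel (\<lambda>z. w * z))"
    by simp
  also have "\<dots> = (\<integral>\<^sup>+ z. indicator A (w * z) \<partial>lborel)"
    by (subst nn_integral_distr) auto
  also have "\<dots> = emeasure lborel A"
    by (subst nn_integral_rotate[OF _ w]) auto
  finally show "emeasure (distr lborel borel (\<lambda>z. w * z)) A = emeasure lborel A" .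
qed simp

section \<open>Moments of radial weights\<close>

lemma borel_measurable_cnj [measurable]: "cnj \<in> borel_measurable borel"
  by (intro borel_measurable_continuous_onI continuous_intros)

text \<open>Rotating the variable by w multiplies the integral by \<open>w ^ a * cnj w ^ b\<close>,
  so a single rotation for which this factor differs from 1 forces the value 0.\<close>

lemma integral_moment_offdiagonal:
  fixes h :: "real \<Rightarrow> real"
  assumes [measurable]: "h \<in> borel_measurable borel" and "a \<noteq> b"
  shows "(\<integral>z. z ^ a * cnj z ^ b * complex_of_real (h (cmod z)) \<partial>lborel) = 0"
    (is "?I a b = 0")
proof -
  define m where "m = \<bar>int a - int b\<bar>"
  have m: "m \<ge> 1" using \<open>a \<noteq> b\<close> by (auto simp: m_def)
  \<comment> \<open>This angle turns the factor into \<i> or - \<i>, and it lies strictly between 0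
    and pi, so that \<open>w\<close> is not real and the rotation lemma applies.\<close>
  define \<theta> where "\<theta> = pi / (2 * of_int m)"
  define w where "w = cis \<theta>"
  have th: "0 < \<theta>" "\<theta> < pi"
    using m pi_gt_zero by (auto simp: \<theta>_def field_simps)
  have w: "cmod w = 1" "Im w \<noteq> 0"
    using sin_gt_zero[OF th] by (auto simp: w_def)
  have "w ^ a * cnj w ^ b = cis (\<theta> * (int a - int b))"
    unfolding w_def cis_cnj Complex.DeMoivre cis_mult
    by (rule arg_cong[where f = cis]) (simp add: algebra_simps)
  also have "\<theta> * (int a - int b) = pi / 2 \<or> \<theta> * (int a - int b) = - (pi / 2)"
  proof -
    have "\<theta> * of_int m = pi / 2" using m by (simp add: \<theta>_def)
    moreover have "int a - int b = m \<or> int a - int b = - m" by (auto simp: m_def)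
    ultimately show ?thesis by (metis mult_minus_right of_int_minus)
  qed
  then have "cis (\<theta> * (int a - int b)) \<noteq> 1"
    by (elim disjE; simp only:) (simp_all add: complex_eq_iff)
  finally have ne: "w ^ a * cnj w ^ b \<noteq> 1" .
  have "?I a b = (\<integral>z. z ^ a * cnj z ^ b * complex_of_real (h (cmod z)) \<partial>distr lborel borel (\<lambda>z. w * z))"
    by (simp add: lborel_distr_rotate[OF w])
  also have "\<dots> = (\<integral>z. (w ^ a * cnj w ^ b) * (z ^ a * cnj z ^ b * complex_of_real (h (cmod z))) \<partial>lborel)"
    by (subst integral_distr)
       (auto simp: norm_mult w power_mult_distrib mult_ac intro!: borel_measurable_times)
  also have "\<dots> = (w ^ a * cnj w ^ b) * ?I a b"
    by (rule integral_mult_right_zero)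
  finally have "(1 - w ^ a * cnj w ^ b) * ?I a b = 0"
    by (simp add: algebra_simps)
  with ne show ?thesis by simp
qed

text \<open>The square of the modulus is the right radial variable: a disc of radius sqrt a has area
  pi * a, so the density is constant on the half-line and moments become beta integrals at
  once.\<close>

lemma distr_lborel_cmod_square:
  "distr (lborel :: complex measure) borel (\<lambda>z. (cmod z)\<^sup>2) =
     density lborel (\<lambda>s. ennreal (pi * indicator {0..} s))" (is "?M = ?N")
proof (rule measure_eqI_generator_eq[where E = "range (\<lambda>a::real. {..a})" and \<Omega> = UNIV and A = "\<lambda>i. {..real i}"])
  show "Int_stable (range (\<lambda>a::real. {..a}))"
    by (auto simp: Int_stable_def)
  have M: "emeasure ?M {..a} = ennreal (pi * max a 0)" for a
  proof (cases "a \<ge> 0")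
    case True
    have "(\<lambda>z. (cmod z)\<^sup>2) -` {..a} \<inter> space lborel = cball 0 (sqrt a)"
      using True by (auto simp: real_le_rsqrt dest: real_le_rsqrt) (metis norm_ge_zero power_mono real_sqrt_pow2)
    then show ?thesis
      using True by (subst emeasure_distr) (auto simp: emeasure_cball eval_unit_ball_vol)
  next
    case False
    then have "(\<lambda>z::complex. (cmod z)\<^sup>2) -` {..a} \<inter> space lborel = {}"
      by (auto dest: order.trans[OF zero_le_power2])
    then show ?thesis using False by (subst emeasure_distr) auto
  qed
  show "emeasure ?M X = emeasure ?N X" if "X \<in> range (\<lambda>a::real. {..a})" for X
  proof -
    from that obtain a where X: "X = {..a}" by auto
    have "emeasure ?N {..a} = (\<integral>\<^sup>+ s. ennreal pi * indicator {0..a} s \<partial>lborel)"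
      by (subst emeasure_density) (auto intro!: nn_integral_cong simp: indicator_def)
    also have "\<dots> = ennreal pi * ennreal (max a 0)"
      by (subst nn_integral_cmult_indicator) (auto simp: emeasure_lborel_Icc_eq max_def ennreal_neg)
    also have "\<dots> = ennreal (pi * max a 0)"
      by (simp add: ennreal_mult)
    finally show ?thesis by (simp add: X M)
  qed
  show "emeasure ?M {..real i} \<noteq> \<infinity>" for i by (simp add: M)
  show "sets ?M = sigma_sets UNIV (range (\<lambda>a::real. {..a}))" "sets ?N = sigma_sets UNIV (range (\<lambda>a::real. {..a}))"
    by (simp_all add: borel_eq_atMost)
  show "(\<Union>i. {..real i}) = (UNIV :: real set)"
    by (auto intro: real_arch_simple)
qed auto

lemma integral_radial:
  fixes f :: "real \<Rightarrow> real"
  assumes [measurable]: "f \<in> borel_measurable borel"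
  shows "(\<integral>z. f ((cmod z)\<^sup>2) \<partial>lborel) = pi * (\<integral>s. indicator {0..} s * f s \<partial>lborel)"
proof -
  have "(\<integral>z. f ((cmod z)\<^sup>2) \<partial>lborel) = (\<integral>s. f s \<partial>density lborel (\<lambda>s. ennreal (pi * indicator {0..} s)))"
    unfolding distr_lborel_cmod_square[symmetric] by (subst integral_distr) auto
  also have "\<dots> = (\<integral>s. pi * indicator {0..} s * f s \<partial>lborel)"
    by (subst integral_density) auto
  finally show ?thesis by (simp add: mult.assoc)
qed

section \<open>The distribution of the largest modulus\<close>

text \<open>A pair of permutations contributes a product of one-variable moments; if the two differ
  at some index, the factor there is an off-diagonal moment, hence 0. The n! diagonal pairs
  contribute equally, since the signs square to 1 and a permutation only reorders the
  moments.\<close>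

lemma integral_vandermonde_square:
  fixes h :: "real \<Rightarrow> real"
  assumes h [measurable]: "h \<in> borel_measurable borel"
    and int: "\<And>k. integrable lborel (\<lambda>z::complex. cmod z ^ k * h (cmod z))"
  shows "has_bochner_integral (\<Pi>\<^sub>M j\<in>{1..n}. (lborel :: complex measure))
    (\<lambda>z. (\<Prod>j<n. \<Prod>i<j. (cmod (z (Suc j) - z (Suc i)))\<^sup>2) * (\<Prod>j\<in>{1..n}. h (cmod (z j))))
    (fact n * (\<Prod>k<n. \<integral>z. cmod z ^ (2 * k) * h (cmod z) \<partial>(lborel :: complex measure)))"
    (is "has_bochner_integral ?M ?f ?x")
proof -
  interpret product_sigma_finite "\<lambda>_::nat. lborel :: complex measure" ..
  define J where "J k = (\<integral>z. cmod z ^ (2 * k) * h (cmod z) \<partial>(lborel :: complex measure))" for k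
  define F where "F a b z = z ^ a * cnj z ^ b * complex_of_real (h (cmod z))" for a b z
  have F_int: "integrable lborel (F a b)" for a b
  proof (rule Bochner_Integration.integrable_bound[OF int[of "a + b"]])
    show "F a b \<in> borel_measurable lborel"
      unfolding F_def by (intro borel_measurable_times borel_measurable_power) measurable
  qed (auto simp: F_def norm_mult norm_power power_add abs_mult)
  have F_integral: "integral\<^sup>L lborel (F a b) = (if a = b then complex_of_real (J a) else 0)" for a b
  proof (cases "a = b")
    case True
    have "F a a = (\<lambda>z. complex_of_real (cmod z ^ (2 * a) * h (cmod z)))"
      by (rule ext) (simp add: F_def power_mult_distrib[symmetric] complex_norm_square[symmetric] power_mult)
    then show ?thesis using True by (simp add: J_def del: of_real_mult)
  next
    case False
    then show ?thesis
      unfolding F_def using integral_moment_offdiagonal[OF h False] by simp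
  qed
  let ?P = "{\<sigma>. \<sigma> permutes {..<n}}"
  \<comment> \<open>Vector components are numbered from 1, exponents from 0; hence
    \<open>j - 1\<close>.\<close>
  define T where "T \<sigma> \<tau> z = (\<Prod>j\<in>{1..n}. F (\<sigma> (j - 1)) (\<tau> (j - 1)) (z j))" for \<sigma> \<tau> :: "nat \<Rightarrow> nat" and z
  have T: "has_bochner_integral ?M (T \<sigma> \<tau>) (if \<tau> = \<sigma> then complex_of_real (\<Prod>k<n. J k) else 0)"
    if "\<sigma> \<in> ?P" "\<tau> \<in> ?P" for \<sigma> \<tau>
  proof -
    have T_int: "integrable ?M (T \<sigma> \<tau>)"
      unfolding T_def by (rule product_integrable_prod) (auto simp: F_int)
    have "integral\<^sup>L ?M (T \<sigma> \<tau>) = (\<Prod>j\<in>{1..n}. if \<sigma> (j - 1) = \<tau> (j - 1) then complex_of_real (J (\<sigma> (j - 1))) else 0)"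
      unfolding T_def by (subst product_integral_prod) (auto simp: F_int F_integral intro!: prod.cong)
    also have "\<dots> = (\<Prod>i<n. if \<sigma> i = \<tau> i then complex_of_real (J (\<sigma> i)) else 0)"
      by (rule prod.reindex_bij_witness[of _ Suc "\<lambda>j. j - 1"]) auto
    also have "\<dots> = (if \<tau> = \<sigma> then complex_of_real (\<Prod>k<n. J k) else 0)"
    proof (cases "\<tau> = \<sigma>")
      case True
      have "(\<Prod>i<n. J (\<sigma> i)) = (\<Prod>k<n. J k)"
        using that(1) by (intro prod.reindex_bij_betw permutes_imp_bij) auto
      then show ?thesis using True by (simp flip: of_real_prod)
    next
      case False
      then obtain i where "\<sigma> i \<noteq> \<tau> i" by (metis ext)
      moreover from this have "i < n"
        using that by (metis mem_Collect_eq lessThan_iff permutes_not_in)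
      ultimately have "(\<Prod>i<n. if \<sigma> i = \<tau> i then complex_of_real (J (\<sigma> i)) else 0) = 0"
        by (intro prod_zero bexI[of _ i]) auto
      then show ?thesis using False by simp
    qed
    finally show ?thesis using T_int by (simp add: has_bochner_integral_iff)
  qed
  have fin: "finite ?P" by (simp add: finite_permutations)
  have expand: "complex_of_real (?f z) = (\<Sum>\<sigma>\<in>?P. \<Sum>\<tau>\<in>?P. of_int (sign \<sigma> * sign \<tau>) * T \<sigma> \<tau> z)" for z
  proof -
    have T_eq: "T \<sigma> \<tau> z = (\<Prod>i<n. F (\<sigma> i) (\<tau> i) (z (Suc i)))" for \<sigma> \<tau>
      unfolding T_def by (rule prod.reindex_bij_witness[of _ Suc "\<lambda>j. j - 1"]) auto
    have "complex_of_real (\<Prod>j<n. \<Prod>i<j. (cmod (z (Suc j) - z (Suc i)))\<^sup>2)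
       = (\<Prod>j<n. \<Prod>i<j. z (Suc j) - z (Suc i)) * cnj (\<Prod>j<n. \<Prod>i<j. z (Suc j) - z (Suc i))"
      by (simp add: prod.distrib[symmetric] complex_norm_square flip: of_real_power)
    also have "\<dots> = (\<Sum>\<sigma>\<in>?P. of_int (sign \<sigma>) * (\<Prod>i<n. z (Suc i) ^ \<sigma> i)) *
        (\<Sum>\<tau>\<in>?P. of_int (sign \<tau>) * (\<Prod>i<n. cnj (z (Suc i)) ^ \<tau> i))"
      unfolding vandermonde_leibniz by simp
    finally have "complex_of_real (?f z) = (\<Sum>\<sigma>\<in>?P. of_int (sign \<sigma>) * (\<Prod>i<n. z (Suc i) ^ \<sigma> i)) *
        (\<Sum>\<tau>\<in>?P. of_int (sign \<tau>) * (\<Prod>i<n. cnj (z (Suc i)) ^ \<tau> i)) * (\<Prod>j\<in>{1..n}. complex_of_real (h (cmod (z j))))"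
      by simp
    also have "(\<Prod>j\<in>{1..n}. complex_of_real (h (cmod (z j)))) = (\<Prod>i<n. complex_of_real (h (cmod (z (Suc i)))))"
      by (rule prod.reindex_bij_witness[of _ Suc "\<lambda>j. j - 1"]) auto
    also have "(\<Sum>\<sigma>\<in>?P. of_int (sign \<sigma>) * (\<Prod>i<n. z (Suc i) ^ \<sigma> i)) *
        (\<Sum>\<tau>\<in>?P. of_int (sign \<tau>) * (\<Prod>i<n. cnj (z (Suc i)) ^ \<tau> i)) * (\<Prod>i<n. complex_of_real (h (cmod (z (Suc i)))))
      = (\<Sum>\<sigma>\<in>?P. \<Sum>\<tau>\<in>?P. of_int (sign \<sigma> * sign \<tau>) * (\<Prod>i<n. F (\<sigma> i) (\<tau> i) (z (Suc i))))"
      unfolding sum_product sum_distrib_right F_def prod.distrib by (simp add: sum_distrib_left mult_ac)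
    finally show ?thesis unfolding T_eq .
  qed
  have "has_bochner_integral ?M (\<lambda>z. \<Sum>\<sigma>\<in>?P. \<Sum>\<tau>\<in>?P. of_int (sign \<sigma> * sign \<tau>) * T \<sigma> \<tau> z)
     (\<Sum>\<sigma>\<in>?P. \<Sum>\<tau>\<in>?P. of_int (sign \<sigma> * sign \<tau>) * (if \<tau> = \<sigma> then complex_of_real (\<Prod>k<n. J k) else 0))"
    by (intro has_bochner_integral_sum has_bochner_integral_mult_right T) auto
  also have "(\<Sum>\<sigma>\<in>?P. \<Sum>\<tau>\<in>?P. of_int (sign \<sigma> * sign \<tau>) * (if \<tau> = \<sigma> then complex_of_real (\<Prod>k<n. J k) else 0))
      = (\<Sum>\<sigma>\<in>?P. complex_of_real (\<Prod>k<n. J k))"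
  proof (intro sum.cong refl)
    fix \<sigma> assume "\<sigma> \<in> ?P"
    have "(\<Sum>\<tau>\<in>?P. of_int (sign \<sigma> * sign \<tau>) * (if \<tau> = \<sigma> then complex_of_real (\<Prod>k<n. J k) else 0))
      = (\<Sum>\<tau>\<in>?P. if \<tau> = \<sigma> then of_int (sign \<sigma> * sign \<sigma>) * complex_of_real (\<Prod>k<n. J k) else 0)"
      by (intro sum.cong) (auto simp: sign_def)
    also have "\<dots> = complex_of_real (\<Prod>k<n. J k)"
      using \<open>\<sigma> \<in> ?P\<close> fin by (simp add: sum.delta sign_def)
    finally show "(\<Sum>\<tau>\<in>?P. of_int (sign \<sigma> * sign \<tau>) * (if \<tau> = \<sigma> then complex_of_real (\<Prod>k<n. J k) else 0))
      = complex_of_real (\<Prod>k<n. J k)" .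
  qed
  also have "\<dots> = complex_of_real ?x"
    by (simp add: card_permutations[OF refl] J_def)
  finally have "has_bochner_integral ?M (\<lambda>z. complex_of_real (?f z)) (complex_of_real ?x)"
    unfolding expand .
  then show ?thesis
    unfolding has_bochner_integral_iff complex_of_real_integrable_eq integral_complex_of_real of_real_eq_iff .
qed

section \<open>Incomplete beta integrals and the law of the maximum\<close>

text \<open>The probability of at most \<open>k\<close> failures before the \<open>r\<close>-th success when each trial fails
  with probability \<open>u\<close>. It equals the probability that a \<open>Beta(k + 1, r)\<close> variable exceeds \<open>u\<close>,
  which is why its derivative collapses to a single term. Meant for \<open>r > 0\<close>.\<close>

definition nbinom_cdf :: "nat \<Rightarrow> nat \<Rightarrow> real \<Rightarrow> real" where
  "nbinom_cdf r k u = (1 - u) ^ r * (\<Sum>i\<le>k. real ((r - 1 + i) choose i) * u ^ i)"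

text \<open>In the induction step the \<open>u ^ k\<close> part of the new derivative cancels the
  inherited one up to an extra factor u. The coefficients k + 1 and q + 1 then add up, and the
  absorption identity \<open>binom\<close> turns the result into the next binomial
  coefficient.\<close>

lemma nbinom_cdf_has_derivative:
  "((\<lambda>u. nbinom_cdf (Suc q) k u) has_real_derivative
     - (real (Suc k * ((q + Suc k) choose Suc k)) * u ^ k * (1 - u) ^ q)) (at u)"
proof (induction k)
  case 0
  have eq: "nbinom_cdf (Suc q) 0 = (\<lambda>u. (1 - u) ^ Suc q)"
    by (simp add: nbinom_cdf_def fun_eq_iff)
  show ?case unfolding eq
    by (auto intro!: derivative_eq_intros simp del: power_Suc)
next
  case (Suc k)
  have eq: "nbinom_cdf (Suc q) (Suc k) =
      (\<lambda>u. nbinom_cdf (Suc q) k u + (1 - u) ^ Suc q * (real ((q + Suc k) choose Suc k) * u ^ Suc k))"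
    by (simp add: nbinom_cdf_def fun_eq_iff algebra_simps)
  have binom: "real (Suc (Suc k) * ((q + Suc (Suc k)) choose Suc (Suc k)))
      = real (q + Suc (Suc k)) * real ((q + Suc k) choose Suc k)"
    using Suc_times_binomial[of "Suc k" "q + Suc k"] by (metis add_Suc_right of_nat_mult)
  show ?case
    unfolding eq
    by (rule derivative_eq_intros Suc.IH refl)+
       (unfold binom, simp add: algebra_simps)
qed

lemma nbinom_cdf_0: "nbinom_cdf r k 0 = 1"
  by (simp add: nbinom_cdf_def power_0_left if_distrib[of "\<lambda>x. _ * x"] sum.delta cong: if_cong)

lemma nbinom_cdf_1: "r > 0 \<Longrightarrow> nbinom_cdf r k 1 = 0"
  by (simp add: nbinom_cdf_def)

lemma integral_beta_incomplete:
  fixes x :: real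
  assumes "0 \<le> x"
  shows "(\<integral>s. indicator {0..x} s * (s ^ k * (1 - s) ^ q) \<partial>lborel) =
     (1 - nbinom_cdf (Suc q) k x) / real (Suc k * ((q + Suc k) choose Suc k))"
proof -
  \<comment> \<open>This is the reciprocal of the beta function at (k + 1, q + 1).\<close>
  define K where "K = real (Suc k * ((q + Suc k) choose Suc k))"
  have K: "K > 0" unfolding K_def by (simp del: mult_Suc binomial_Suc_Suc)
  have "(\<integral>s. indicator {0..x} s *\<^sub>R (s ^ k * (1 - s) ^ q) \<partial>lborel)
      = - nbinom_cdf (Suc q) k x / K - (- nbinom_cdf (Suc q) k 0 / K)"
  proof (rule integral_FTC_Icc)
    fix s :: real
    have D: "(nbinom_cdf (Suc q) k has_real_derivative - (K * s ^ k * (1 - s) ^ q)) (at s)"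
      unfolding K_def by (rule nbinom_cdf_has_derivative)
    have "((\<lambda>s. - nbinom_cdf (Suc q) k s / K) has_real_derivative s ^ k * (1 - s) ^ q) (at s within {0..x})"
      using K by (auto intro!: derivative_eq_intros has_field_derivative_at_within[OF D])
    then show "((\<lambda>s. - nbinom_cdf (Suc q) k s / K) has_vector_derivative s ^ k * (1 - s) ^ q) (at s within {0..x})"
      by (simp add: has_real_derivative_iff_has_vector_derivative)
  qed (auto intro!: continuous_intros assms)
  then show ?thesis
    by (simp add: nbinom_cdf_0 K_def diff_divide_distrib del: mult_Suc binomial_Suc_Suc of_nat_mult)
qed

text \<open>The one-variable factor of the density on the event that the maximum is at most x. With
  the bound by 1 built in, x = 1 yields the total mass.\<close>

definition disc_weight :: "nat \<Rightarrow> real \<Rightarrow> real \<Rightarrow> real" where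
  "disc_weight q x \<rho> = (if \<rho> < 1 \<and> \<rho> \<le> x then (1 - \<rho>\<^sup>2) ^ q else 0)"

lemma disc_weight_measurable [measurable]: "disc_weight q x \<in> borel_measurable borel"
  unfolding disc_weight_def by measurable

lemma integrable_disc_weight:
  "integrable lborel (\<lambda>z::complex. cmod z ^ k * disc_weight q x (cmod z))"
proof (rule Bochner_Integration.integrable_bound)
  show "integrable lborel (indicator (ball (0::complex) 1) :: complex \<Rightarrow> real)"
    using emeasure_lborel_ball_finite by (intro integrable_real_indicator) auto
  show "AE z::complex in lborel. norm (cmod z ^ k * disc_weight q x (cmod z)) \<le> norm (indicator (ball 0 1) z :: real)"
    by (auto simp: disc_weight_def indicator_def power_le_one abs_mult power_abs abs_square_le_1
        intro!: mult_le_one)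
qed measurable

lemma integral_disc_weight:
  assumes "0 \<le> x" "x \<le> 1"
  shows "(\<integral>z. cmod z ^ (2 * k) * disc_weight q x (cmod z) \<partial>(lborel :: complex measure)) =
     pi * (1 - nbinom_cdf (Suc q) k (x\<^sup>2)) / real (Suc k * ((q + Suc k) choose Suc k))"
proof -
  have "(\<integral>z. cmod z ^ (2 * k) * disc_weight q x (cmod z) \<partial>(lborel :: complex measure))
     = (\<integral>z. (\<lambda>s. s ^ k * disc_weight q x (sqrt s)) ((cmod z)\<^sup>2) \<partial>(lborel :: complex measure))"
    by (simp add: power_mult)
  also have "\<dots> = pi * (\<integral>s. indicator {0..} s * (s ^ k * disc_weight q x (sqrt s)) \<partial>lborel)"
    by (rule integral_radial) measurable
  also have "(\<integral>s. indicator {0..} s * (s ^ k * disc_weight q x (sqrt s)) \<partial>lborel)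
     = (\<integral>s. indicator {0..x\<^sup>2} s * (s ^ k * (1 - s) ^ q) \<partial>lborel)"
  proof (rule integral_cong_AE)
    \<comment> \<open>Equality can fail at s = 1 when x = 1 and q = 0: the open disc gives 0 there,
      whereas \<open>(1 - s) ^ q\<close> is 1.\<close>
    show "AE s in lborel. indicator {0..} s * (s ^ k * disc_weight q x (sqrt s)) =
        indicator {0..x\<^sup>2} s * (s ^ k * (1 - s) ^ q)"
      using AE_lborel_singleton[of "1::real"]
    proof eventually_elim
      case (elim s)
      have "sqrt s \<le> x \<longleftrightarrow> s \<le> x\<^sup>2" if "s \<ge> 0"
        using that assms by (metis real_le_lsqrt real_sqrt_le_iff real_sqrt_unique sqrt_le_D)
      moreover have "x\<^sup>2 \<le> 1" using assms by (simp add: power_le_one)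
      ultimately show ?case
        using elim by (auto simp: disc_weight_def indicator_def)
    qed
  qed measurable
  finally show ?thesis
    using integral_beta_incomplete[of "x\<^sup>2" k q] by simp
qed

text \<open>The case x = 1 identifies \<open>C\<close> as the reciprocal of \<open>S 1\<close>, so
  the probability is \<open>S x / S 1\<close>; the factorial, the powers of pi and the beta
  constants cancel in this quotient.\<close>

lemma max_modulus_distribution:
  fixes Z :: "nat \<Rightarrow> 'a \<Rightarrow> complex"
  assumes "prob_space M" "p < n" "0 \<le> x" "x \<le> 1"
    and dist: "distributed M (\<Pi>\<^sub>M j\<in>{1..p}. (lborel :: complex measure))
        (\<lambda>\<omega>. \<lambda>j\<in>{1..p}. Z j \<omega>) (\<lambda>z. ennreal (truncated_unitary_density n p C z))"
  shows "measure M {\<omega> \<in> space M. \<forall>j\<in>{1..p}. cmod (Z j \<omega>) \<le> x} =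
    (\<Prod>k<p. 1 - nbinom_cdf (n - p) k (x\<^sup>2))"
proof -
  interpret prob_space M by fact
  let ?N = "\<Pi>\<^sub>M j\<in>{1..p}. (lborel :: complex measure)"
  define q where "q = n - p - 1"
  have nq: "n - p = Suc q" using \<open>p < n\<close> by (simp add: q_def)
  define f where "f x z = (\<Prod>j<p. \<Prod>i<j. (cmod (z (Suc j) - z (Suc i)))\<^sup>2) * (\<Prod>j\<in>{1..p}. disc_weight q x (cmod (z j)))"
    for x and z :: "nat \<Rightarrow> complex"
  define S where "S x = fact p * (\<Prod>k<p. pi * (1 - nbinom_cdf (Suc q) k (x\<^sup>2)) / real (Suc k * ((q + Suc k) choose Suc k)))" for x
  define A where "A x = {z \<in> space ?N. \<forall>j\<in>{1..p}. cmod (z j) \<le> x}" for x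
  have A [measurable]: "A x \<in> sets ?N" for x
    unfolding A_def by measurable
  have f_nonneg: "f x z \<ge> 0" for x z
    unfolding f_def disc_weight_def
    by (intro mult_nonneg_nonneg prod_nonneg ballI zero_le_power2) (auto simp: abs_square_le_1)
  have f_int: "has_bochner_integral ?N (f x) (S x)" if "0 \<le> x" "x \<le> 1" for x
    using integral_vandermonde_square[where h = "disc_weight q x" and n = p, OF disc_weight_measurable integrable_disc_weight]
    unfolding f_def S_def integral_disc_weight[OF that] .
  have dens: "truncated_unitary_density n p C z * indicator (A x) z = C * f x z"
    if "z \<in> space ?N" "x \<le> 1" for x z
  proof -
    have "(\<Prod>(j, k)\<in>{(j, k). 1 \<le> j \<and> j < k \<and> k \<le> p}. (cmod (z j - z k))\<^sup>2)
       = (\<Prod>(k, j)\<in>(SIGMA k:{..<p}. {..<k}). (cmod (z (Suc k) - z (Suc j)))\<^sup>2)"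
      by (rule prod.reindex_bij_witness[of _ "\<lambda>(k, j). (Suc j, Suc k)" "\<lambda>(j, k). (k - 1, j - 1)"])
         (auto simp: norm_minus_commute)
    also have "\<dots> = (\<Prod>j<p. \<Prod>i<j. (cmod (z (Suc j) - z (Suc i)))\<^sup>2)"
      by (subst prod.Sigma) auto
    finally have V: "(\<Prod>(j, k)\<in>{(j, k). 1 \<le> j \<and> j < k \<and> k \<le> p}. (cmod (z j - z k))\<^sup>2)
       = (\<Prod>j<p. \<Prod>i<j. (cmod (z (Suc j) - z (Suc i)))\<^sup>2)" .
    show ?thesis
    proof (cases "\<forall>j\<in>{1..p}. cmod (z j) < 1 \<and> cmod (z j) \<le> x")
      case True
      then have "(\<Prod>j\<in>{1..p}. disc_weight q x (cmod (z j))) = (\<Prod>j\<in>{1..p}. (1 - (cmod (z j))\<^sup>2) ^ q)"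
        by (intro prod.cong) (auto simp: disc_weight_def)
      then show ?thesis
        using True that by (simp add: truncated_unitary_density_def A_def f_def V q_def del: One_nat_def)
    next
      case False
      then obtain j where "j \<in> {1..p}" "\<not> (cmod (z j) < 1 \<and> cmod (z j) \<le> x)" by auto
      then have "(\<Prod>j\<in>{1..p}. disc_weight q x (cmod (z j))) = 0"
        by (intro prod_zero bexI[of _ j]) (auto simp: disc_weight_def)
      moreover have "truncated_unitary_density n p C z * indicator (A x) z = 0"
        using False by (auto simp: truncated_unitary_density_def A_def indicator_def)
      ultimately show ?thesis unfolding f_def by (simp only: mult_zero_right)
    qed
  qed
  \<comment> \<open>\<open>ennreal (C * f x z)\<close> splits into a product because
    \<open>f\<close> is nonnegative; the sign of \<open>C\<close> is known only later, from the
    total mass.\<close>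
  have prob_A: "emeasure M {\<omega> \<in> space M. (\<lambda>j\<in>{1..p}. Z j \<omega>) \<in> A x} = ennreal C * ennreal (S x)"
    if "0 \<le> x" "x \<le> 1" for x
  proof -
    have "emeasure M {\<omega> \<in> space M. (\<lambda>j\<in>{1..p}. Z j \<omega>) \<in> A x}
        = emeasure M ((\<lambda>\<omega>. \<lambda>j\<in>{1..p}. Z j \<omega>) -` A x \<inter> space M)"
      by (rule arg_cong[where f = "emeasure M"]) auto
    also have "\<dots> = (\<integral>\<^sup>+ z. ennreal (truncated_unitary_density n p C z) * indicator (A x) z \<partial>?N)"
      by (rule distributed_emeasure[OF dist A])
    also have "\<dots> = (\<integral>\<^sup>+ z. ennreal C * ennreal (f x z) \<partial>?N)"
    proof (rule nn_integral_cong)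
      fix z assume "z \<in> space ?N"
      then show "ennreal (truncated_unitary_density n p C z) * indicator (A x) z = ennreal C * ennreal (f x z)"
        using dens[of z x] that f_nonneg[of x z]
        by (simp add: ennreal_mult''[symmetric] ennreal_indicator[symmetric])
    qed
    also have "\<dots> = ennreal C * (\<integral>\<^sup>+ z. ennreal (f x z) \<partial>?N)"
      using f_int[OF that] by (intro nn_integral_cmult) (auto dest: borel_measurable_has_bochner_integral)
    also have "(\<integral>\<^sup>+ z. ennreal (f x z) \<partial>?N) = ennreal (S x)"
      using f_int[OF that] f_nonneg
      by (subst nn_integral_eq_integral) (auto simp: has_bochner_integral_iff)
    finally show ?thesis .
  qed
  have space: "(\<lambda>j\<in>{1..p}. Z j \<omega>) \<in> space ?N" if "\<omega> \<in> space M" for \<omega>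
    by (auto simp: space_PiM)
  have set_eq: "{\<omega> \<in> space M. (\<lambda>j\<in>{1..p}. Z j \<omega>) \<in> A x} = {\<omega> \<in> space M. \<forall>j\<in>{1..p}. cmod (Z j \<omega>) \<le> x}" for x
    using space by (auto simp: A_def)
  have total: "ennreal C * ennreal (S 1) = 1"
  proof -
    have "1 = emeasure M ((\<lambda>\<omega>. \<lambda>j\<in>{1..p}. Z j \<omega>) -` space ?N \<inter> space M)"
      using space emeasure_space_1 by (subst Int_absorb1) auto
    also have "\<dots> = (\<integral>\<^sup>+ z. ennreal (truncated_unitary_density n p C z) * indicator (space ?N) z \<partial>?N)"
      by (rule distributed_emeasure[OF dist]) simp
    also have "\<dots> = (\<integral>\<^sup>+ z. ennreal (truncated_unitary_density n p C z) * indicator (A 1) z \<partial>?N)"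
      by (rule nn_integral_cong)
         (auto simp: A_def truncated_unitary_density_def indicator_def split: if_splits dest: less_imp_le)
    also have "\<dots> = emeasure M ((\<lambda>\<omega>. \<lambda>j\<in>{1..p}. Z j \<omega>) -` A 1 \<inter> space M)"
      by (rule distributed_emeasure[OF dist A, symmetric])
    also have "\<dots> = emeasure M {\<omega> \<in> space M. (\<lambda>j\<in>{1..p}. Z j \<omega>) \<in> A 1}"
      by (rule arg_cong[where f = "emeasure M"]) auto
    finally show ?thesis using prob_A[of 1] by simp
  qed
  have S_eq: "S x = S 1 * (\<Prod>k<p. 1 - nbinom_cdf (n - p) k (x\<^sup>2))" for x
  proof -
    have "S x = fact p * ((\<Prod>k<p. pi / real (Suc k * ((q + Suc k) choose Suc k))) * (\<Prod>k<p. 1 - nbinom_cdf (n - p) k (x\<^sup>2)))"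
      unfolding S_def nq prod.distrib[symmetric] by simp
    moreover have "S 1 = fact p * (\<Prod>k<p. pi / real (Suc k * ((q + Suc k) choose Suc k)))"
      unfolding S_def by (simp add: nbinom_cdf_1)
    ultimately show ?thesis by simp
  qed
  have S_nonneg: "S x \<ge> 0" if "0 \<le> x" "x \<le> 1" for x
  proof -
    have "S x = integral\<^sup>L ?N (f x)"
      using f_int[OF that] by (simp add: has_bochner_integral_iff)
    then show ?thesis by (simp add: f_nonneg)
  qed
  have "C * S 1 = 1"
  proof -
    have "ennreal (C * S 1) = 1" using total S_nonneg[of 1] by (simp add: ennreal_mult'')
    then show ?thesis by (simp only: ennreal_eq_1)
  qed
  then have "C > 0"
    using S_nonneg[of 1] by (smt (verit) mult_nonpos_nonneg)
  have "S x \<ge> 0" using S_nonneg assms by simp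
  have "measure M {\<omega> \<in> space M. \<forall>j\<in>{1..p}. cmod (Z j \<omega>) \<le> x} = C * S x"
    using prob_A[of x] assms \<open>C > 0\<close> \<open>S x \<ge> 0\<close>
    unfolding set_eq measure_def by (simp add: ennreal_mult[symmetric])
  also have "\<dots> = (\<Prod>k<p. 1 - nbinom_cdf (n - p) k (x\<^sup>2))"
    unfolding S_eq[of x] using \<open>C * S 1 = 1\<close> by (simp add: mult.assoc[symmetric])
  finally show ?thesis .
qed

section \<open>Gumbel norming and Stirling's formula\<close>

definition gumbel_point :: "real \<Rightarrow> real \<Rightarrow> real" where
  "gumbel_point t y = ln y powr (1/2) - ln y powr (-1/2) * ln (sqrt (2 * pi) * ln y) + ln y powr (-1/2) * t"

lemma gumbel_point_at_top: "filterlim (gumbel_point t) at_top at_top"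
  unfolding gumbel_point_def by real_asymp

text \<open>Controls the cubic Taylor remainder of the exponent in the local approximation of the
  weights.\<close>

lemma gumbel_point_cube: "((\<lambda>y. gumbel_point t y ^ 3 / sqrt y) \<longlongrightarrow> 0) at_top"
  unfolding gumbel_point_def by real_asymp

text \<open>The equation for which the norming is made. With L = ln y and l = ln (sqrt (2 pi) * L),
  the square of the point is L + 2 (t - l) + (t - l)^2 / L. After halving and exponentiating, L
  cancels \<open>sqrt y\<close>, l cancels sqrt (2 pi) up to the quotient of L and the square, which
  tends to 1, and exp (- t) remains.\<close>

lemma gumbel_point_tail:
  "((\<lambda>y. sqrt y / (sqrt (2 * pi) * (gumbel_point t y)\<^sup>2) * exp (- (gumbel_point t y)\<^sup>2 / 2)) \<longlongrightarrow> exp (- t)) at_top"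
proof -
  define l where "l L = ln (sqrt (2 * pi) * L)" for L
  have "((\<lambda>y. ln y / (gumbel_point t y)\<^sup>2 * exp (- (t - l (ln y))\<^sup>2 / (2 * ln y)) * exp (- t)) \<longlongrightarrow> 1 * 1 * exp (- t)) at_top"
  proof (intro tendsto_mult tendsto_const)
    show "((\<lambda>y. ln y / (gumbel_point t y)\<^sup>2) \<longlongrightarrow> 1) at_top"
      unfolding gumbel_point_def by real_asymp
    show "((\<lambda>y. exp (- (t - l (ln y))\<^sup>2 / (2 * ln y))) \<longlongrightarrow> 1) at_top"
      unfolding l_def by real_asymp
  qed
  moreover have "\<forall>\<^sub>F y in at_top. ln y / (gumbel_point t y)\<^sup>2 * exp (- (t - l (ln y))\<^sup>2 / (2 * ln y)) * exp (- t)
     = sqrt y / (sqrt (2 * pi) * (gumbel_point t y)\<^sup>2) * exp (- (gumbel_point t y)\<^sup>2 / 2)"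
    using eventually_gt_at_top[of 1]
  proof eventually_elim
    case (elim y)
    define L where "L = ln y"
    have L: "L > 0" using elim by (simp add: L_def)
    have g: "gumbel_point t y = sqrt L + (t - l L) / sqrt L"
      using L by (simp add: gumbel_point_def L_def[symmetric] l_def powr_half_sqrt powr_minus_divide field_simps)
    have "(gumbel_point t y)\<^sup>2 = L + 2 * (t - l L) + (t - l L)\<^sup>2 / L"
      using L unfolding g by (simp add: power2_sum power_divide)
    then have e: "- (gumbel_point t y)\<^sup>2 / 2 = - (L / 2) + - t + l L + - (t - l L)\<^sup>2 / (2 * L)"
      by (simp add: field_simps)
    have y: "sqrt y = exp (L / 2)"
      using elim by (simp add: L_def ln_sqrt[symmetric])
    have "exp (l L) = sqrt (2 * pi) * L"
      using L by (simp add: l_def)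
    then have "sqrt y * exp (- (gumbel_point t y)\<^sup>2 / 2)
       = (sqrt (2 * pi) * L) * exp (- t) * exp (- (t - l L)\<^sup>2 / (2 * L))"
      unfolding e exp_add y by (simp add: exp_minus)
    then have *: "sqrt y * exp (- (gumbel_point t y)\<^sup>2 / 2) / (sqrt (2 * pi) * (gumbel_point t y)\<^sup>2)
       = (sqrt (2 * pi) * L) * exp (- t) * exp (- (t - l L)\<^sup>2 / (2 * L)) / (sqrt (2 * pi) * (gumbel_point t y)\<^sup>2)"
      by simp
    show ?case
      using * by (simp add: L_def[symmetric] mult_ac)
  qed
  ultimately show ?thesis
    by (simp add: filterlim_cong)
qed

text \<open>For 0 \<le> x \<le> 1/2 the logarithm of 1 - x lies between - x - 2 x^2 and - x. The
  accumulated quadratic error is at most \<open>2 * e n\<close> times the sum, which vanishes since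
  the sum converges.\<close>

lemma prod_one_minus_tendsto_exp:
  fixes q :: "nat \<Rightarrow> nat \<Rightarrow> real"
  assumes q: "\<forall>\<^sub>F n in sequentially. \<forall>k\<in>A n. 0 \<le> q n k \<and> q n k \<le> e n"
    and e: "e \<longlonglongrightarrow> 0" and sum: "(\<lambda>n. \<Sum>k\<in>A n. q n k) \<longlonglongrightarrow> c"
  shows "(\<lambda>n. \<Prod>k\<in>A n. 1 - q n k) \<longlonglongrightarrow> exp (- c)"
proof (rule tendsto_sandwich)
  have small: "\<forall>\<^sub>F n in sequentially. e n < 1/2"
    using e by (rule order_tendstoD) simp
  show "\<forall>\<^sub>F n in sequentially. exp (- ((\<Sum>k\<in>A n. q n k) + 2 * e n * (\<Sum>k\<in>A n. q n k))) \<le> (\<Prod>k\<in>A n. 1 - q n k)"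
    using small q
  proof eventually_elim
    case (elim n)
    have "exp (- ((\<Sum>k\<in>A n. q n k) + 2 * e n * (\<Sum>k\<in>A n. q n k))) = exp (\<Sum>k\<in>A n. - q n k - 2 * e n * q n k)"
      by (simp add: sum_subtractf sum_negf sum_distrib_left)
    also have "\<dots> \<le> (\<Prod>k\<in>A n. 1 - q n k)"
    \<comment> \<open>Over an infinite index set the sum is 0 and the product 1 by convention, so
      the bound holds there too.\<close>
    proof (cases "finite (A n)")
      case True
      have "(\<Prod>k\<in>A n. exp (- q n k - 2 * e n * q n k)) \<le> (\<Prod>k\<in>A n. 1 - q n k)"
      proof (rule prod_mono, intro conjI)
        fix k assume "k \<in> A n"
        then have k: "0 \<le> q n k" "q n k \<le> e n" "q n k \<le> 1/2" using elim by force+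
        have "(q n k)\<^sup>2 \<le> e n * q n k" using k by (simp add: power2_eq_square mult_right_mono)
        then have "- q n k - 2 * e n * q n k \<le> ln (1 - q n k)"
          using ln_one_minus_pos_lower_bound[OF k(1,3)] by linarith
        then show "exp (- q n k - 2 * e n * q n k) \<le> 1 - q n k"
          using k by (simp add: ln_ge_iff)
      qed simp
      then show ?thesis using True by (simp add: exp_sum)
    qed simp
    finally show ?case .
  qed
  show "\<forall>\<^sub>F n in sequentially. (\<Prod>k\<in>A n. 1 - q n k) \<le> exp (- (\<Sum>k\<in>A n. q n k))"
    using small q
  proof eventually_elim
    case (elim n)
    show ?case
    proof (cases "finite (A n)")
      case True
      have "(\<Prod>k\<in>A n. 1 - q n k) \<le> (\<Prod>k\<in>A n. exp (- q n k))"
        using elim by (intro prod_mono) (force intro: order.trans[OF _ exp_ge_add_one_self])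
      then show ?thesis using True by (simp add: exp_sum flip: sum_negf)
    qed simp
  qed
  have "(\<lambda>n. exp (- ((\<Sum>k\<in>A n. q n k) + 2 * e n * (\<Sum>k\<in>A n. q n k)))) \<longlonglongrightarrow> exp (- (c + 2 * 0 * c))"
    by (intro tendsto_intros e sum)
  then show "(\<lambda>n. exp (- ((\<Sum>k\<in>A n. q n k) + 2 * e n * (\<Sum>k\<in>A n. q n k)))) \<longlonglongrightarrow> exp (- c)" by simp
  show "(\<lambda>n. exp (- (\<Sum>k\<in>A n. q n k))) \<longlonglongrightarrow> exp (- c)"
    by (intro tendsto_intros sum)
qed

section \<open>Stirling's formula\<close>

definition stirling_quotient :: "nat \<Rightarrow> real" where
  "stirling_quotient n = fact n / (sqrt n * (real n / exp 1) ^ n)"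

text \<open>The increments of the logarithm are \<open>O(1 / n^2)\<close>, so a limit exists; its value is read off
  from the product formula for \<open>Gamma (1/2)\<close>.\<close>

lemma stirling_quotient_tendsto: "stirling_quotient \<longlonglongrightarrow> sqrt (2 * pi)"
proof -
  \<comment> \<open>The shift avoids index 0, where the quotient is a division by zero.\<close>
  define L where "L n = ln (stirling_quotient (Suc n))" for n
  have pos: "stirling_quotient (Suc n) > 0" for n
    unfolding stirling_quotient_def by (intro divide_pos_pos mult_pos_pos) auto
  have L_eq: "L n = ln (fact (Suc n)) - (real (Suc n) + 1/2) * ln (real (Suc n)) + real (Suc n)" for n
    unfolding L_def stirling_quotient_def
    by (simp add: ln_div ln_mult ln_realpow ln_sqrt algebra_simps del: of_nat_Suc fact_Suc power_Suc)
  have diff: "L (Suc n) - L n = 1 - (real (Suc n) + 1/2) * ln (real (Suc (Suc n)) / real (Suc n))" for n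
  proof -
    have "ln (fact (Suc (Suc n)) :: real) = ln (real (Suc (Suc n))) + ln (fact (Suc n))"
      by (subst fact_Suc, subst ln_mult) (auto simp del: fact_Suc)
    then show ?thesis
      unfolding L_eq by (simp add: ln_div algebra_simps del: fact_Suc)
  qed
  \<comment> \<open>The summand 1/2 in (m + 1/2) * ln (1 + 1/m) removes the term of order 1/m; it
    comes from the square root in the quotient.\<close>
  have "(\<lambda>n. L (Suc n) - L n) \<in> O(\<lambda>n. 1 / real n ^ 2)"
    unfolding diff by real_asymp
  moreover have "summable (\<lambda>n. norm (1 / real n ^ 2))"
    using inverse_power_summable[of 2, where ?'a = real] by (simp add: field_simps)
  ultimately have "summable (\<lambda>n. L (Suc n) - L n)"
    by (rule summable_comparison_test_bigo[rotated])
  then have "(\<lambda>n. (\<Sum>i<n. L (Suc i) - L i) + L 0) \<longlonglongrightarrow> (\<Sum>n. L (Suc n) - L n) + L 0"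
    by (intro tendsto_intros summable_LIMSEQ)
  then obtain c where "L \<longlonglongrightarrow> c" by (simp add: sum_lessThan_telescope)
  then have "(\<lambda>n. exp (L n)) \<longlonglongrightarrow> exp c" by (intro tendsto_intros)
  moreover have "exp (L n) = stirling_quotient (Suc n)" for n
    using pos[of n] by (simp add: L_def)
  ultimately have lim: "stirling_quotient \<longlonglongrightarrow> exp c"
    by (simp add: filterlim_sequentially_Suc)
  \<comment> \<open>By fact (2 n) = 4^n * pochhammer (1/2) n * fact n, this sequence is
    \<open>Gamma_series (1/2)\<close> for n > 0. Comparing the two limits gives exp c / sqrt 2 =
    sqrt pi.\<close>
  have "(\<lambda>n. (stirling_quotient n)\<^sup>2 / stirling_quotient (2 * n) * (real n / (sqrt 2 * (real n + 1/2)))) \<longlonglongrightarrow> (exp c)\<^sup>2 / exp c * (1 / sqrt 2)"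
  proof (rule tendsto_mult)
    have "(\<lambda>n. stirling_quotient (2 * n)) \<longlonglongrightarrow> exp c"
      by (rule filterlim_compose[OF lim]) real_asymp
    then show "(\<lambda>n. (stirling_quotient n)\<^sup>2 / stirling_quotient (2 * n)) \<longlonglongrightarrow> (exp c)\<^sup>2 / exp c"
      by (intro tendsto_divide tendsto_power lim) auto
    have "(\<lambda>n. 1 / sqrt 2 * (real n / (real n + 1 / 2))) \<longlonglongrightarrow> 1 / sqrt 2 * 1"
      by (intro tendsto_mult tendsto_const) real_asymp
    then show "(\<lambda>n. real n / (sqrt 2 * (real n + 1 / 2))) \<longlonglongrightarrow> 1 / sqrt 2" by simp
  qed
  moreover have "\<forall>\<^sub>F n in sequentially. (stirling_quotient n)\<^sup>2 / stirling_quotient (2 * n) * (real n / (sqrt 2 * (real n + 1/2))) = Gamma_series (1/2) n"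
    using eventually_gt_at_top[of 0]
  proof eventually_elim
    case (elim n)
    have f2: "fact (2 * n) = (2 ^ (2 * n) * pochhammer (1/2) n * fact n :: real)"
      by (rule fact_double)
    have poch: "pochhammer (1/2 :: real) n > 0" by (rule pochhammer_pos) simp
    define d where "d = real n + 1/2"
    have d: "d > 0" by (simp add: d_def)
    have g: "Gamma_series (1/2) n = fact n * sqrt n / (pochhammer (1/2) n * d)"
      using elim by (simp add: d_def add.commute Gamma_series_def pochhammer_Suc ln_sqrt[symmetric] del: ln_sqrt)
    have st: "(stirling_quotient n)\<^sup>2 / stirling_quotient (2 * n) = fact n * sqrt n * sqrt 2 / (pochhammer (1/2) n * real n)"
      unfolding stirling_quotient_def f2 using elim poch
      by (simp add: power_divide power_mult_distrib real_sqrt_mult field_simps power_mult power2_eq_square)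
    show ?case using elim poch d unfolding d_def[symmetric] g st by (simp add: field_simps)
  qed
  ultimately have "Gamma_series (1/2) \<longlonglongrightarrow> (exp c)\<^sup>2 / exp c * (1 / sqrt 2)"
    using tendsto_cong by fast
  moreover have "Gamma_series (1/2 :: real) \<longlonglongrightarrow> Gamma (1/2)" by (rule Gamma_series_LIMSEQ)
  ultimately have "(exp c)\<^sup>2 / exp c * (1 / sqrt 2) = sqrt pi"
    using LIMSEQ_unique by (metis Gamma_one_half_real)
  then have "exp c = sqrt (2 * pi)"
    by (simp add: power2_eq_square field_simps real_sqrt_mult)
  with lim show ?thesis by simp
qed

section \<open>Sums of negative binomial distribution functions\<close>

lemma nbinom_cdf_altdef:
  "nbinom_cdf r k u = (\<Sum>i\<le>k. (1 - u) ^ r * (real ((r - 1 + i) choose i) * u ^ i))"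
  by (simp add: nbinom_cdf_def sum_distrib_left)

lemma sum_Suc_times_power:
  fixes x :: real
  assumes "x \<noteq> 1"
  shows "(\<Sum>m\<le>K. real (Suc m) * x ^ m) = (1 - x ^ Suc K * (1 + real (Suc K) * (1 - x))) / (1 - x)\<^sup>2"
proof -
  have "(\<Sum>m\<le>K. real (Suc m) * x ^ m) * (1 - x)\<^sup>2 = 1 - x ^ Suc K * (1 + real (Suc K) * (1 - x))"
    by (induction K) (simp_all add: algebra_simps power2_eq_square)
  then show ?thesis using assms by (simp add: field_simps)
qed

locale nbinom =
  fixes r P :: nat and u :: real
  assumes r: "r \<ge> 1" and u: "0 < u" "u < 1"
begin

definition w :: "nat \<Rightarrow> real" where
  "w i = (1 - u) ^ r * (real ((r - 1 + i) choose i) * u ^ i)"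

text \<open>Ratios are counted downwards from the top index P, because in the application the
  weights are largest there and decay with the distance from it.\<close>

definition \<rho> :: "nat \<Rightarrow> real" where
  "\<rho> l = real (P - l) / (real (r - 1 + (P - l)) * u)"

lemma w_nonneg: "w i \<ge> 0"
  using u by (simp add: w_def)

lemma cdf_eq: "nbinom_cdf r k u = (\<Sum>i\<le>k. w i)"
  by (simp add: nbinom_cdf_altdef w_def)

lemma cdf_nonneg: "nbinom_cdf r k u \<ge> 0"
  unfolding cdf_eq by (intro sum_nonneg w_nonneg)

lemma cdf_mono: "k \<le> P \<Longrightarrow> nbinom_cdf r k u \<le> nbinom_cdf r P u"
  unfolding cdf_eq by (intro sum_mono2 w_nonneg) auto

lemma cdf_reverse: "nbinom_cdf r P u = (\<Sum>m\<le>P. w (P - m))"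
  unfolding cdf_eq by (rule sum.reindex_bij_witness[of _ "\<lambda>m. P - m" "\<lambda>m. P - m"]) auto

text \<open>The weight at distance m below the top occurs in exactly the m + 1 distribution
  functions with index from \<open>P - m\<close> to \<open>P\<close>.\<close>

lemma sum_cdf: "(\<Sum>k\<le>P. nbinom_cdf r k u) = (\<Sum>m\<le>P. real (Suc m) * w (P - m))"
proof -
  have "(\<Sum>k\<le>P. nbinom_cdf r k u) = (\<Sum>i\<le>P. real (Suc (P - i)) * w i)"
  proof -
    have "(\<Sum>k\<le>n. \<Sum>i\<le>k. w i) = (\<Sum>i\<le>n. real (Suc (n - i)) * w i)" for n
    proof (induction n)
      case (Suc n)
      have "(\<Sum>i\<le>n. real (Suc (Suc n - i)) * w i) = (\<Sum>i\<le>n. real (Suc (n - i)) * w i + w i)"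
        by (intro sum.cong) (auto simp: Suc_diff_le algebra_simps)
      then show ?case using Suc by (simp add: sum.distrib)
    qed simp
    then show ?thesis by (simp add: cdf_eq)
  qed
  also have "\<dots> = (\<Sum>m\<le>P. real (Suc m) * w (P - m))"
    by (rule sum.reindex_bij_witness[of _ "\<lambda>m. P - m" "\<lambda>m. P - m"]) auto
  finally show ?thesis .
qed

lemma w_step: "l < P \<Longrightarrow> w (P - Suc l) = w (P - l) * \<rho> l"
proof -
  assume "l < P"
  then obtain i where i: "P - l = Suc i" "P - Suc l = i"
    by (metis Suc_diff_Suc)
  define r' where "r' = r - 1"
  have "real (Suc i) * real (Suc (r' + i) choose Suc i) = real (Suc (r' + i)) * real ((r' + i) choose i)"
    using Suc_times_binomial[of i "r' + i"] by (metis of_nat_mult)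
  then have "(1 - u) ^ r * u ^ Suc i * (real (Suc i) * real (Suc (r' + i) choose Suc i)) =
      (1 - u) ^ r * u ^ Suc i * (real (Suc (r' + i)) * real ((r' + i) choose i))" by simp
  moreover have "r - 1 + Suc i = Suc (r' + i)" "r - 1 + i = r' + i" by (auto simp: r'_def)
  ultimately have "w (Suc i) * real (Suc i) = w i * (real (Suc (r' + i)) * u)"
    unfolding w_def by (simp add: mult_ac del: binomial_Suc_Suc of_nat_Suc)
  moreover have "real (Suc (r' + i)) * u \<noteq> 0" using u by simp
  ultimately have "w i = w (Suc i) * (real (Suc i) / (real (Suc (r' + i)) * u))"
    by (metis nonzero_mult_div_cancel_right times_divide_eq_right)
  then show ?thesis
    unfolding i \<rho>_def r'_def[symmetric] by (simp add: add.commute)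
qed

lemma \<rho>_nonneg: "\<rho> l \<ge> 0"
  using u by (simp add: \<rho>_def)

text \<open>x / (c + x) increases with x. So the ratio at the top bounds all ratios from above, and
  the ratio at depth K bounds those before it from below: these are the two geometric
  comparisons.\<close>

lemma \<rho>_antimono: "l \<le> m \<Longrightarrow> m < P \<Longrightarrow> \<rho> m \<le> \<rho> l"
proof -
  assume lm: "l \<le> m" "m < P"
  define a b where "a = real (P - m)" and "b = real (P - l)"
  have ab: "0 < a" "a \<le> b" using lm by (auto simp: a_def b_def)
  define r' where "r' = r - 1"
  have "a * (real r' + b) \<le> b * (real r' + a)"
    using ab mult_right_mono[of a b "real r'"] by (simp add: algebra_simps)
  then have "a / (real r' + a) \<le> b / (real r' + b)"
    using ab by (simp add: divide_simps)
  then have "a / (real r' + a) / u \<le> b / (real r' + b) / u"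
    using u by (intro divide_right_mono) auto
  then show ?thesis unfolding \<rho>_def r'_def[symmetric] by (simp add: a_def b_def)
qed

lemma w_upper: "m \<le> P \<Longrightarrow> w (P - m) \<le> w P * \<rho> 0 ^ m"
proof (induction m)
  case (Suc m)
  have "w (P - Suc m) = w (P - m) * \<rho> m" using Suc.prems by (intro w_step) simp
  also have "\<dots> \<le> (w P * \<rho> 0 ^ m) * \<rho> 0"
    using Suc by (intro mult_mono \<rho>_antimono \<rho>_nonneg mult_nonneg_nonneg w_nonneg zero_le_power) auto
  finally show ?case by (simp add: mult_ac)
qed simp

lemma w_lower: "K < P \<Longrightarrow> m \<le> K \<Longrightarrow> w P * \<rho> K ^ m \<le> w (P - m)"
proof (induction m)
  case (Suc m)
  have "w P * \<rho> K ^ Suc m = (w P * \<rho> K ^ m) * \<rho> K" by simp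
  also have "\<dots> \<le> w (P - m) * \<rho> m"
    using Suc by (intro mult_mono \<rho>_antimono \<rho>_nonneg mult_nonneg_nonneg w_nonneg zero_le_power) auto
  also have "\<dots> = w (P - Suc m)" using Suc.prems by (intro w_step[symmetric]) simp
  finally show ?case .
qed simp

lemma sum_cdf_upper:
  assumes "\<rho> 0 < 1"
  shows "(\<Sum>k\<le>P. nbinom_cdf r k u) \<le> w P / (1 - \<rho> 0)\<^sup>2"
proof -
  have "(\<Sum>k\<le>P. nbinom_cdf r k u) \<le> (\<Sum>m\<le>P. real (Suc m) * (w P * \<rho> 0 ^ m))"
    unfolding sum_cdf by (intro sum_mono mult_left_mono w_upper) auto
  also have "\<dots> = w P * (\<Sum>m\<le>P. real (Suc m) * \<rho> 0 ^ m)"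
    by (simp add: sum_distrib_left mult_ac)
  also have "\<dots> \<le> w P * (1 / (1 - \<rho> 0)\<^sup>2)"
    using assms \<rho>_nonneg[of 0]
    by (intro mult_left_mono w_nonneg, subst sum_Suc_times_power) (auto intro!: divide_right_mono)
  finally show ?thesis by simp
qed

lemma cdf_upper:
  assumes "\<rho> 0 < 1"
  shows "nbinom_cdf r P u \<le> w P / (1 - \<rho> 0)"
proof -
  have "nbinom_cdf r P u \<le> (\<Sum>m\<le>P. w P * \<rho> 0 ^ m)"
    unfolding cdf_reverse by (intro sum_mono w_upper) auto
  also have "\<dots> = w P * ((1 - \<rho> 0 ^ Suc P) / (1 - \<rho> 0))"
    using assms by (simp add: sum_distrib_left[symmetric] sum_gp0)
  also have "\<dots> \<le> w P * (1 / (1 - \<rho> 0))"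
    using assms \<rho>_nonneg[of 0] by (intro mult_left_mono w_nonneg divide_right_mono) auto
  finally show ?thesis by simp
qed

text \<open>Only the first K + 1 terms are kept, so that \<open>\<rho> K\<close> is a lower bound
  for the ratios between them. The last factor bounds the relative loss from truncating the series
  of (m + 1) x^m, using x \<le> exp (- (1 - x)); it is near 1 once (K + 1) (1 -
  \<open>\<rho> K\<close>) is large.\<close>

lemma sum_cdf_lower:
  assumes "\<rho> 0 < 1" "K < P"
  shows "w P / (1 - \<rho> K)\<^sup>2 * (1 - (1 + real (Suc K) * (1 - \<rho> K)) * exp (- (real (Suc K) * (1 - \<rho> K))))
     \<le> (\<Sum>k\<le>P. nbinom_cdf r k u)"
proof -
  have K1: "\<rho> K < 1" using \<rho>_antimono[of 0 K] assms by simp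
  have "\<rho> K ^ Suc K \<le> exp (- (1 - \<rho> K)) ^ Suc K"
    using exp_ge_add_one_self[of "- (1 - \<rho> K)"] \<rho>_nonneg by (intro power_mono) auto
  also have "\<dots> = exp (- (real (Suc K) * (1 - \<rho> K)))"
    unfolding exp_of_nat_mult[symmetric] by (simp add: algebra_simps)
  finally have "\<rho> K ^ Suc K * (1 + real (Suc K) * (1 - \<rho> K)) \<le> exp (- (real (Suc K) * (1 - \<rho> K))) * (1 + real (Suc K) * (1 - \<rho> K))"
    using K1 by (intro mult_right_mono) auto
  then have "w P / (1 - \<rho> K)\<^sup>2 * (1 - (1 + real (Suc K) * (1 - \<rho> K)) * exp (- (real (Suc K) * (1 - \<rho> K))))
     \<le> w P / (1 - \<rho> K)\<^sup>2 * (1 - \<rho> K ^ Suc K * (1 + real (Suc K) * (1 - \<rho> K)))"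
    by (intro mult_left_mono divide_nonneg_nonneg w_nonneg) (auto simp: mult.commute)
  also have "\<dots> = w P * (\<Sum>m\<le>K. real (Suc m) * \<rho> K ^ m)"
    using K1 by (subst sum_Suc_times_power) auto
  also have "\<dots> = (\<Sum>m\<le>K. real (Suc m) * (w P * \<rho> K ^ m))"
    by (simp add: sum_distrib_left mult_ac)
  also have "\<dots> \<le> (\<Sum>m\<le>K. real (Suc m) * w (P - m))"
    using assms by (intro sum_mono mult_left_mono w_lower) auto
  also have "\<dots> \<le> (\<Sum>m\<le>P. real (Suc m) * w (P - m))"
    using assms by (intro sum_mono2 mult_nonneg_nonneg w_nonneg) auto
  finally show ?thesis by (simp add: sum_cdf)
qed

end

section \<open>Moderate deviations\<close>

text \<open>Handles the factors built from p / n, which are bounded but need not converge.\<close>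

lemma tendsto_zero_bounded_mult:
  fixes f g :: "'a \<Rightarrow> real"
  assumes "(f \<longlongrightarrow> 0) F" "\<forall>\<^sub>F x in F. \<bar>g x\<bar> \<le> B"
  shows "((\<lambda>x. g x * f x) \<longlongrightarrow> 0) F"
proof (rule tendsto_0_le[OF assms(1), where K = B])
  show "\<forall>\<^sub>F x in F. norm (g x * f x) \<le> norm (f x) * B"
    using assms(2) by eventually_elim (simp add: abs_mult mult.commute[of _ B] mult_right_mono)
qed

text \<open>In the application \<open>N = n - 1\<close>, \<open>P = p - 1\<close> and \<open>s = a\<^sub>n + b\<^sub>n t\<close>; then \<open>sqrt q\<close> is \<open>c\<^sub>n\<close>
  and \<open>\<epsilon>\<close> is chosen so that \<open>sqrt u = sqrt q * (1 + \<epsilon>)\<close> is \<open>A\<^sub>n + B\<^sub>n t\<close>.\<close>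

locale nbinom_asymp =
  fixes N P :: "nat \<Rightarrow> nat" and s :: "nat \<Rightarrow> real" and l \<kappa>1 \<kappa>2 :: real
  fixes q Y \<epsilon> u :: "nat \<Rightarrow> real"
  defines "q \<equiv> \<lambda>n. real (P n) / real (N n)"
    and "Y \<equiv> \<lambda>n. real (N n) * q n / (1 - q n)"
    and "\<epsilon> \<equiv> \<lambda>n. s n / (2 * sqrt (Y n))"
    and "u \<equiv> \<lambda>n. q n * (1 + \<epsilon> n)\<^sup>2"
  assumes \<kappa>: "0 < \<kappa>1" "\<kappa>2 < 1"
    and N_lim: "filterlim N at_top sequentially"
    and q_bounds: "\<forall>\<^sub>F n in sequentially. \<kappa>1 \<le> q n \<and> q n \<le> \<kappa>2"
    and s_lim: "filterlim s at_top sequentially"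
    and s_cube: "(\<lambda>n. s n ^ 3 / sqrt (Y n)) \<longlonglongrightarrow> 0"
    and s_tail: "(\<lambda>n. sqrt (Y n) / (sqrt (2 * pi) * (s n)\<^sup>2) * exp (- (s n)\<^sup>2 / 2)) \<longlonglongrightarrow> l"
begin

lemma rN_lim: "filterlim (\<lambda>n. real (N n)) at_top sequentially"
  by (rule filterlim_compose[OF filterlim_real_sequentially N_lim])

lemma base: "\<forall>\<^sub>F n in sequentially. 0 < P n \<and> P n < N n \<and> 2 \<le> N n \<and> 0 < s n \<and>
    \<kappa>1 \<le> q n \<and> q n \<le> \<kappa>2 \<and> 0 < q n \<and> q n < 1 \<and> real (P n) = q n * real (N n) \<and> 0 < Y n \<and> 0 < \<epsilon> n"
proof -
  have "\<forall>\<^sub>F n in sequentially. 2 \<le> N n"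
    using N_lim by (simp add: filterlim_at_top)
  moreover have "\<forall>\<^sub>F n in sequentially. 0 < s n"
    using s_lim by (simp add: filterlim_at_top_dense)
  ultimately show ?thesis
    using q_bounds
  proof eventually_elim
    case (elim n)
    then have q: "0 < q n" "q n < 1" using \<kappa> by auto
    then have "0 < P n" "P n < N n" using elim unfolding q_def
      by (auto simp: field_simps intro!: gr0I)
    moreover have "0 < Y n" using q elim by (simp add: Y_def)
    moreover have "0 < \<epsilon> n" using \<open>0 < Y n\<close> elim by (simp add: \<epsilon>_def)
    ultimately show ?case using q elim by (auto simp: q_def)
  qed
qed

definition g :: "nat \<Rightarrow> real" where "g n = q n / (1 - q n)"

lemma Y_eq: "Y n = real (N n) * g n"
  by (simp add: Y_def g_def)

lemma g_bounds: "\<forall>\<^sub>F n in sequentially. \<kappa>1 \<le> g n \<and> g n \<le> \<kappa>2 / (1 - \<kappa>2)"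
  using base
proof eventually_elim
  case (elim n)
  then have "q n * (1 - q n) \<le> q n" by (simp add: algebra_simps)
  then have "q n \<le> g n" using elim by (simp add: g_def field_simps)
  moreover have "g n \<le> \<kappa>2 / (1 - \<kappa>2)"
    unfolding g_def using elim \<kappa> by (intro frac_le) auto
  ultimately show ?case using elim by linarith
qed

lemma inverse_s_lim: "(\<lambda>n. 1 / s n) \<longlonglongrightarrow> 0"
  using tendsto_inverse_0_at_top[OF s_lim] by (simp add: field_simps)

lemma inverse_N_lim: "(\<lambda>n. 1 / real (N n)) \<longlonglongrightarrow> 0"
  using tendsto_inverse_0_at_top[OF rN_lim] by (simp add: field_simps)

lemma \<epsilon>_lim: "\<epsilon> \<longlonglongrightarrow> 0"
proof -
  have "(\<lambda>n. 1/2 * (s n ^ 3 / sqrt (Y n)) * (1 / s n)\<^sup>2) \<longlonglongrightarrow> 1/2 * 0 * 0\<^sup>2"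
    by (intro tendsto_intros s_cube inverse_s_lim)
  moreover have "\<forall>\<^sub>F n in sequentially. 1/2 * (s n ^ 3 / sqrt (Y n)) * (1 / s n)\<^sup>2 = \<epsilon> n"
    using base by eventually_elim (simp add: \<epsilon>_def power2_eq_square power3_eq_cube)
  ultimately show ?thesis using tendsto_cong by fastforce
qed

lemma N_\<epsilon>_cube_lim: "(\<lambda>n. real (N n) * \<epsilon> n ^ 3) \<longlonglongrightarrow> 0"
proof -
  have "(\<lambda>n. 1 / (8 * g n) * (s n ^ 3 / sqrt (Y n))) \<longlonglongrightarrow> 0"
  proof (rule tendsto_zero_bounded_mult[OF s_cube])
    show "\<forall>\<^sub>F n in sequentially. \<bar>1 / (8 * g n)\<bar> \<le> 1 / (8 * \<kappa>1)"
      using g_bounds by eventually_elim (use \<kappa> in \<open>auto intro!: frac_le\<close>)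
  qed
  moreover have "\<forall>\<^sub>F n in sequentially. 1 / (8 * g n) * (s n ^ 3 / sqrt (Y n)) = real (N n) * \<epsilon> n ^ 3"
    using base g_bounds
  proof eventually_elim
    case (elim n)
    then have "g n > 0" using \<kappa> by linarith
    have "sqrt (Y n) ^ 3 = Y n * sqrt (Y n)" using elim by (simp add: power3_eq_cube)
    then show ?case using elim \<open>g n > 0\<close>
      by (simp add: \<epsilon>_def power_divide power_mult_distrib Y_eq)
  qed
  ultimately show ?thesis using tendsto_cong by fastforce
qed

text \<open>The product in the denominator is s / (2 sqrt g), which tends to infinity with s: the
  deviation is larger than the central limit scale. This leaves room for a cut-off of order sqrt
  N.\<close>

lemma inverse_\<epsilon>_sqrt_N_lim: "(\<lambda>n. 1 / (\<epsilon> n * sqrt (real (N n)))) \<longlonglongrightarrow> 0"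
proof -
  have "(\<lambda>n. 2 * sqrt (g n) * (1 / s n)) \<longlonglongrightarrow> 0"
  proof (rule tendsto_zero_bounded_mult[OF inverse_s_lim])
    show "\<forall>\<^sub>F n in sequentially. \<bar>2 * sqrt (g n)\<bar> \<le> 2 * sqrt (\<kappa>2 / (1 - \<kappa>2))"
      using g_bounds by eventually_elim (use \<kappa> in auto)
  qed
  moreover have "\<forall>\<^sub>F n in sequentially. 2 * sqrt (g n) * (1 / s n) = 1 / (\<epsilon> n * sqrt (real (N n)))"
    using base by eventually_elim (simp add: \<epsilon>_def Y_eq real_sqrt_mult)
  ultimately show ?thesis using tendsto_cong by fastforce
qed

lemma inverse_\<epsilon>_N_lim: "(\<lambda>n. 1 / (\<epsilon> n * real (N n))) \<longlonglongrightarrow> 0"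
proof -
  have "(\<lambda>n. 1 / (\<epsilon> n * sqrt (real (N n))) * sqrt (1 / real (N n))) \<longlonglongrightarrow> 0 * sqrt 0"
    by (intro tendsto_mult tendsto_real_sqrt inverse_\<epsilon>_sqrt_N_lim inverse_N_lim)
  moreover have "1 / (\<epsilon> n * sqrt (real (N n))) * sqrt (1 / real (N n)) = 1 / (\<epsilon> n * real (N n))" for n
    by (simp add: real_sqrt_divide mult.assoc)
  ultimately show ?thesis by simp
qed

lemma u_bounds: "\<forall>\<^sub>F n in sequentially. \<kappa>1 \<le> u n \<and> 0 < u n \<and> u n < 1"
proof -
  have \<kappa>2: "0 < \<kappa>2"
  proof -
    have "\<forall>\<^sub>F n in sequentially. 0 < \<kappa>2" using base by eventually_elim auto
    then show ?thesis by simp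
  qed
  have "(\<lambda>n. \<kappa>2 * (1 + \<epsilon> n)\<^sup>2) \<longlonglongrightarrow> \<kappa>2 * (1 + 0)\<^sup>2"
    by (intro tendsto_intros \<epsilon>_lim)
  then have "\<forall>\<^sub>F n in sequentially. \<kappa>2 * (1 + \<epsilon> n)\<^sup>2 < 1"
    using \<kappa> by (intro order_tendstoD) auto
  with base show ?thesis
  proof eventually_elim
    case (elim n)
    have "1 \<le> (1 + \<epsilon> n)\<^sup>2" using elim by (intro one_le_power) auto
    then have "q n * 1 \<le> u n" unfolding u_def using elim by (intro mult_left_mono) auto
    moreover have "u n \<le> \<kappa>2 * (1 + \<epsilon> n)\<^sup>2" unfolding u_def using elim by (intro mult_right_mono) auto
    ultimately show ?case using elim by auto
  qed
qed

text \<open>Chosen so that 1 - u = (1 - q) (1 - \<eta>), the counterpart of u = q (1 +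
  \<epsilon>)^2.\<close>

definition \<eta> :: "nat \<Rightarrow> real" where "\<eta> n = g n * (2 * \<epsilon> n + (\<epsilon> n)\<^sup>2)"

text \<open>Minus N times the relative entropy of the Bernoulli law with parameter q with respect to
  the one with parameter u: the exponent that Stirling's formula leaves behind.\<close>

definition \<Psi> :: "nat \<Rightarrow> real" where
  "\<Psi> n = real (N n) * (2 * q n * ln (1 + \<epsilon> n) + (1 - q n) * ln (1 - \<eta> n))"

lemma one_minus_\<eta>: "q n \<noteq> 1 \<Longrightarrow> 1 - \<eta> n = (1 - u n) / (1 - q n)"
  by (simp add: \<eta>_def g_def u_def field_simps power2_eq_square)

lemma \<eta>_lim: "\<eta> \<longlonglongrightarrow> 0"
  unfolding \<eta>_def
proof (rule tendsto_zero_bounded_mult)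
  have "(\<lambda>n. 2 * \<epsilon> n + (\<epsilon> n)\<^sup>2) \<longlonglongrightarrow> 2 * 0 + 0\<^sup>2"
    by (intro tendsto_intros \<epsilon>_lim)
  then show "(\<lambda>n. 2 * \<epsilon> n + (\<epsilon> n)\<^sup>2) \<longlonglongrightarrow> 0" by simp
  show "\<forall>\<^sub>F n in sequentially. \<bar>g n\<bar> \<le> \<kappa>2 / (1 - \<kappa>2)"
    using g_bounds by eventually_elim (use \<kappa> in auto)
qed

text \<open>Both logarithms are expanded to second order. The linear terms cancel because (1 - q) g
  = q, and the quadratic ones sum to - 2 N g \<epsilon>^2 = - s^2 / 2 because q (1 + g) = g. All
  that remains is a bounded factor times N \<epsilon>^3.\<close>

lemma \<Psi>_lim: "(\<lambda>n. \<Psi> n + (s n)\<^sup>2 / 2) \<longlonglongrightarrow> 0"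
proof -
  \<comment> \<open>Taylor remainders divided by x^3. They have limits as x tends to 0 from the
    right, hence the one-sided filters for \<epsilon> and \<eta>.\<close>
  define R1 R2 where "R1 x = (ln (1 + x) - x + x\<^sup>2 / 2) / x ^ 3"
    and "R2 x = (ln (1 - x) + x + x\<^sup>2 / 2) / x ^ 3" for x :: real
  have \<epsilon>0: "filterlim \<epsilon> (at_right 0) sequentially"
    using \<epsilon>_lim base by (auto simp: filterlim_at elim!: eventually_mono)
  have "\<forall>\<^sub>F n in sequentially. 0 < \<eta> n"
    using base g_bounds
  proof eventually_elim
    case (elim n)
    then show ?case using \<kappa> unfolding \<eta>_def by (intro mult_pos_pos add_pos_pos) auto
  qed
  then have \<eta>0: "filterlim \<eta> (at_right 0) sequentially"
    using \<eta>_lim by (auto simp: filterlim_at elim!: eventually_mono)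
  have "(R1 \<longlongrightarrow> 1 / 3) (at_right 0)" "(R2 \<longlongrightarrow> - 1 / 3) (at_right 0)"
    unfolding R1_def R2_def by real_asymp+
  then have R: "(\<lambda>n. R1 (\<epsilon> n)) \<longlonglongrightarrow> 1 / 3" "(\<lambda>n. R2 (\<eta> n)) \<longlonglongrightarrow> - 1 / 3"
    using \<epsilon>0 \<eta>0 by (auto intro: filterlim_compose)
  define B where "B = \<kappa>2 / (1 - \<kappa>2)"
  have t1: "(\<lambda>n. (2 * q n) * (R1 (\<epsilon> n) * (real (N n) * \<epsilon> n ^ 3))) \<longlonglongrightarrow> 0"
  proof (rule tendsto_zero_bounded_mult)
    show "(\<lambda>n. R1 (\<epsilon> n) * (real (N n) * \<epsilon> n ^ 3)) \<longlonglongrightarrow> 0"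
      using tendsto_mult[OF R(1) N_\<epsilon>_cube_lim] by simp
    show "\<forall>\<^sub>F n in sequentially. \<bar>2 * q n\<bar> \<le> 2"
      using base by eventually_elim auto
  qed
  have t2: "(\<lambda>n. ((1 - q n) * g n ^ 3) * (R2 (\<eta> n) * (real (N n) * \<epsilon> n ^ 3) * (2 + \<epsilon> n) ^ 3)) \<longlonglongrightarrow> 0"
  proof (rule tendsto_zero_bounded_mult)
    have "(\<lambda>n. R2 (\<eta> n) * (real (N n) * \<epsilon> n ^ 3) * (2 + \<epsilon> n) ^ 3) \<longlonglongrightarrow> - 1 / 3 * 0 * (2 + 0) ^ 3"
      by (intro tendsto_mult R N_\<epsilon>_cube_lim tendsto_power tendsto_add tendsto_const \<epsilon>_lim)
    then show "(\<lambda>n. R2 (\<eta> n) * (real (N n) * \<epsilon> n ^ 3) * (2 + \<epsilon> n) ^ 3) \<longlonglongrightarrow> 0" by simp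
    show "\<forall>\<^sub>F n in sequentially. \<bar>(1 - q n) * g n ^ 3\<bar> \<le> 1 * B ^ 3"
      using base g_bounds
    proof eventually_elim
      case (elim n)
      then have "0 \<le> g n" using \<kappa> by linarith
      then have "\<bar>(1 - q n) * g n ^ 3\<bar> = (1 - q n) * g n ^ 3" using elim by simp
      also have "\<dots> \<le> 1 * B ^ 3"
        using elim \<open>0 \<le> g n\<close> unfolding B_def by (intro mult_mono power_mono) auto
      finally show ?case .
    qed
  qed
  \<comment> \<open>The terms of order three and four in \<epsilon> that the second-order Taylor
    polynomials themselves produce, since \<eta> is quadratic in \<epsilon>.\<close>
  have t3: "(\<lambda>n. (- 2 * q n * g n) * ((real (N n) * \<epsilon> n ^ 3) * (1 + \<epsilon> n / 4))) \<longlonglongrightarrow> 0"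
  proof (rule tendsto_zero_bounded_mult)
    have "(\<lambda>n. (real (N n) * \<epsilon> n ^ 3) * (1 + \<epsilon> n / 4)) \<longlonglongrightarrow> 0 * (1 + 0 / 4)"
      by (intro tendsto_mult N_\<epsilon>_cube_lim tendsto_add tendsto_const tendsto_divide \<epsilon>_lim) auto
    then show "(\<lambda>n. (real (N n) * \<epsilon> n ^ 3) * (1 + \<epsilon> n / 4)) \<longlonglongrightarrow> 0" by simp
    show "\<forall>\<^sub>F n in sequentially. \<bar>- 2 * q n * g n\<bar> \<le> 2 * 1 * B"
      using base g_bounds
    proof eventually_elim
      case (elim n)
      then have "0 \<le> g n" using \<kappa> by linarith
      then have "\<bar>- 2 * q n * g n\<bar> = 2 * q n * g n" using elim by (simp add: abs_mult)
      also have "\<dots> \<le> 2 * 1 * B"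
        using elim \<open>0 \<le> g n\<close> unfolding B_def by (intro mult_mono) auto
      finally show ?case .
    qed
  qed
  have "(\<lambda>n. (2 * q n) * (R1 (\<epsilon> n) * (real (N n) * \<epsilon> n ^ 3)) +
      ((1 - q n) * g n ^ 3) * (R2 (\<eta> n) * (real (N n) * \<epsilon> n ^ 3) * (2 + \<epsilon> n) ^ 3) +
      (- 2 * q n * g n) * ((real (N n) * \<epsilon> n ^ 3) * (1 + \<epsilon> n / 4))) \<longlonglongrightarrow> 0 + 0 + 0"
    by (intro tendsto_add t1 t2 t3)
  moreover have "\<forall>\<^sub>F n in sequentially. (2 * q n) * (R1 (\<epsilon> n) * (real (N n) * \<epsilon> n ^ 3)) +
      ((1 - q n) * g n ^ 3) * (R2 (\<eta> n) * (real (N n) * \<epsilon> n ^ 3) * (2 + \<epsilon> n) ^ 3) +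
      (- 2 * q n * g n) * ((real (N n) * \<epsilon> n ^ 3) * (1 + \<epsilon> n / 4)) = \<Psi> n + (s n)\<^sup>2 / 2"
    using base \<open>\<forall>\<^sub>F n in sequentially. 0 < \<eta> n\<close>
  proof eventually_elim
    case (elim n)
    have q: "q n < 1" using elim by simp
    have R1: "R1 (\<epsilon> n) * \<epsilon> n ^ 3 = ln (1 + \<epsilon> n) - \<epsilon> n + (\<epsilon> n)\<^sup>2 / 2"
      using elim by (simp add: R1_def)
    have "g n ^ 3 * (\<epsilon> n ^ 3 * (2 + \<epsilon> n) ^ 3) = \<eta> n ^ 3"
      unfolding \<eta>_def power_mult_distrib[symmetric] by (simp add: algebra_simps power2_eq_square)
    moreover have "R2 (\<eta> n) * \<eta> n ^ 3 = ln (1 - \<eta> n) + \<eta> n + (\<eta> n)\<^sup>2 / 2"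
      using elim by (simp add: R2_def)
    ultimately have R2: "R2 (\<eta> n) * (g n ^ 3 * (\<epsilon> n ^ 3 * (2 + \<epsilon> n) ^ 3)) = ln (1 - \<eta> n) + \<eta> n + (\<eta> n)\<^sup>2 / 2"
      by simp
    have s2: "(s n)\<^sup>2 / 2 = 2 * real (N n) * g n * (\<epsilon> n)\<^sup>2"
    proof -
      have "(\<epsilon> n)\<^sup>2 * (4 * Y n) = (s n)\<^sup>2"
        using elim by (simp add: \<epsilon>_def power_divide power_mult_distrib)
      then show ?thesis unfolding Y_eq by (simp add: algebra_simps)
    qed
    have gq: "(1 - q n) * g n = q n" using q by (simp add: g_def)
    have g1: "g n = q n + q n * g n" using q by (simp add: g_def field_simps)
    have "2 * q n * (\<epsilon> n - (\<epsilon> n)\<^sup>2 / 2) - (1 - q n) * \<eta> n - (1 - q n) * (\<eta> n)\<^sup>2 / 2 + 2 * g n * (\<epsilon> n)\<^sup>2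
       = - 2 * q n * g n * (\<epsilon> n ^ 3 * (1 + \<epsilon> n / 4))"
    proof -
      have a: "(1 - q n) * \<eta> n = q n * (2 * \<epsilon> n + (\<epsilon> n)\<^sup>2)"
        unfolding \<eta>_def using gq by (simp only: mult.assoc[symmetric])
      have "(1 - q n) * (\<eta> n)\<^sup>2 = ((1 - q n) * \<eta> n) * \<eta> n" by (simp add: power2_eq_square)
      also have "\<dots> = q n * g n * (2 * \<epsilon> n + (\<epsilon> n)\<^sup>2)\<^sup>2"
        unfolding a unfolding \<eta>_def by (simp add: power2_eq_square mult_ac)
      finally have b: "(1 - q n) * (\<eta> n)\<^sup>2 = q n * g n * (2 * \<epsilon> n + (\<epsilon> n)\<^sup>2)\<^sup>2" .
      have "2 * q n * (\<epsilon> n - (\<epsilon> n)\<^sup>2 / 2) - (1 - q n) * \<eta> n - (1 - q n) * (\<eta> n)\<^sup>2 / 2 + 2 * g n * (\<epsilon> n)\<^sup>2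
        = 2 * q n * (\<epsilon> n - (\<epsilon> n)\<^sup>2 / 2) - q n * (2 * \<epsilon> n + (\<epsilon> n)\<^sup>2) - q n * g n * (2 * \<epsilon> n + (\<epsilon> n)\<^sup>2)\<^sup>2 / 2 + 2 * (q n + q n * g n) * (\<epsilon> n)\<^sup>2"
        unfolding a b using g1 by simp
      also have "\<dots> = - 2 * q n * g n * (\<epsilon> n ^ 3 * (1 + \<epsilon> n / 4))"
        by (simp add: field_simps power2_eq_square power3_eq_cube)
      finally show ?thesis .
    qed
    then have t3: "real (N n) * (2 * q n * (\<epsilon> n - (\<epsilon> n)\<^sup>2 / 2) - (1 - q n) * \<eta> n - (1 - q n) * (\<eta> n)\<^sup>2 / 2 + 2 * g n * (\<epsilon> n)\<^sup>2)
       = (- 2 * q n * g n) * ((real (N n) * \<epsilon> n ^ 3) * (1 + \<epsilon> n / 4))" by simp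
    have "(2 * q n) * (R1 (\<epsilon> n) * (real (N n) * \<epsilon> n ^ 3)) +
      ((1 - q n) * g n ^ 3) * (R2 (\<eta> n) * (real (N n) * \<epsilon> n ^ 3) * (2 + \<epsilon> n) ^ 3)
      = real (N n) * (2 * q n * (R1 (\<epsilon> n) * \<epsilon> n ^ 3) + (1 - q n) * (R2 (\<eta> n) * (g n ^ 3 * (\<epsilon> n ^ 3 * (2 + \<epsilon> n) ^ 3))))"
      by (simp add: algebra_simps)
    also have "\<dots> = real (N n) * (2 * q n * (ln (1 + \<epsilon> n) - \<epsilon> n + (\<epsilon> n)\<^sup>2 / 2) + (1 - q n) * (ln (1 - \<eta> n) + \<eta> n + (\<eta> n)\<^sup>2 / 2))"
      unfolding R1 R2 ..
    finally show ?case
      unfolding t3[symmetric] \<Psi>_def s2 by (simp add: algebra_simps)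
  qed
  ultimately show ?thesis by (simp add: tendsto_cong)
qed

end

section \<open>Asymptotics of the weights and the limit of the product\<close>

lemma fact_eq_stirling_quotient:
  "n > 0 \<Longrightarrow> fact n = stirling_quotient n * (sqrt n * (real n / exp 1) ^ n)"
  by (simp add: stirling_quotient_def)

lemma filterlim_nat_at_top_of_real:
  fixes f :: "'a \<Rightarrow> nat"
  assumes "filterlim (\<lambda>x. real (f x)) at_top F"
  shows "filterlim f at_top F"
  unfolding filterlim_at_top
proof
  fix Z
  have "\<forall>\<^sub>F x in F. real Z \<le> real (f x)" using assms unfolding filterlim_at_top by blast
  then show "\<forall>\<^sub>F x in F. Z \<le> f x" by eventually_elim simp
qed

lemma tendsto_eventually_eq:
  "(f \<longlongrightarrow> a) F \<Longrightarrow> \<forall>\<^sub>F x in F. f x = g x \<Longrightarrow> a = b \<Longrightarrow> (g \<longlongrightarrow> b) F"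
  by (auto intro: Lim_transform_eventually)

context nbinom_asymp
begin

definition W :: "nat \<Rightarrow> real" where "W n = nbinom.w (N n - P n) (u n) (P n)"

definition r :: "nat \<Rightarrow> nat \<Rightarrow> real" where "r n = nbinom.\<rho> (N n - P n) (P n) (u n)"

lemma nbinom: "\<forall>\<^sub>F n in sequentially. nbinom (N n - P n) (u n)"
  using base u_bounds by eventually_elim (auto simp: nbinom_def)

text \<open>Stirling's formula for N choose P. The weight itself contains N - 1 choose P, which is
  smaller by the factor 1 - q; in N choose P the powers of N / e cancel.\<close>

lemma W_eq: "\<forall>\<^sub>F n in sequentially. W n = (1 - q n) *
    (stirling_quotient (N n) / (stirling_quotient (P n) * stirling_quotient (N n - P n))) /
    sqrt (real (N n) * q n * (1 - q n)) * exp (\<Psi> n)"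
  using base nbinom u_bounds
proof eventually_elim
  case (elim n)
  define a b M where "a = P n" and "b = N n - P n" and "M = N n"
  have ab: "a > 0" "b > 0" "M = a + b" "M > 0" using elim by (auto simp: a_def b_def M_def)
  have q: "0 < q n" "q n < 1" using elim by auto
  have ra: "real a = q n * real M" using elim by (simp add: a_def M_def)
  then have rb: "real b = (1 - q n) * real M" using ab by (simp add: algebra_simps)
  have "real b * real (M choose a) = real M * real ((M - 1) choose a)"
    using binomial_absorb_comp[of M a] ab by (metis add_diff_cancel_left' of_nat_mult)
  then have C1: "real ((M - 1) choose a) = (1 - q n) * real (M choose a)"
    using ab unfolding rb by simp
  define S where "S = stirling_quotient M / (stirling_quotient a * stirling_quotient b)"
  define e where "e = real M / exp 1"
  have e: "e > 0" using ab by (simp add: e_def)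
  have "real (M choose a) = fact M / (fact a * fact b)"
    using ab by (simp add: binomial_fact)
  also have "\<dots> = S * (sqrt M / (sqrt a * sqrt b)) * (e ^ M / ((real a / exp 1) ^ a * (real b / exp 1) ^ b))"
    using ab by (simp add: fact_eq_stirling_quotient S_def e_def mult_ac)
  also have "real a / exp 1 = q n * e" by (simp add: ra e_def)
  also have "real b / exp 1 = (1 - q n) * e" by (simp add: rb e_def)
  also have "e ^ M / ((q n * e) ^ a * ((1 - q n) * e) ^ b) = 1 / (q n ^ a * (1 - q n) ^ b)"
    using e by (simp add: ab power_mult_distrib power_add)
  also have "sqrt M / (sqrt a * sqrt b) = 1 / sqrt (real M * q n * (1 - q n))"
  proof -
    have "sqrt a * sqrt b = sqrt M * sqrt (real M * q n * (1 - q n))"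
      unfolding ra rb by (simp only: real_sqrt_mult mult_ac)
    then show ?thesis using \<open>M > 0\<close> by simp
  qed
  finally have C2: "real (M choose a) = S * (1 / sqrt (real M * q n * (1 - q n))) * (1 / (q n ^ a * (1 - q n) ^ b))" .
  have \<eta>: "1 - \<eta> n > 0" using elim by (subst one_minus_\<eta>) auto
  have "\<Psi> n = real a * (2 * ln (1 + \<epsilon> n)) + real b * ln (1 - \<eta> n)"
    unfolding \<Psi>_def M_def[symmetric] ra rb by (simp add: algebra_simps)
  also have "2 * ln (1 + \<epsilon> n) = ln ((1 + \<epsilon> n)\<^sup>2)" using elim by (simp add: ln_realpow)
  finally have "exp (\<Psi> n) = ((1 + \<epsilon> n)\<^sup>2) ^ a * (1 - \<eta> n) ^ b"
    using elim \<eta> by (simp add: exp_add exp_of_nat_mult)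
  also have "(1 + \<epsilon> n)\<^sup>2 = u n / q n" using q by (simp add: u_def)
  also have "1 - \<eta> n = (1 - u n) / (1 - q n)" using q by (subst one_minus_\<eta>) auto
  finally have ex: "(1 - u n) ^ b * u n ^ a = q n ^ a * (1 - q n) ^ b * exp (\<Psi> n)"
    using q by (simp add: power_divide)
  have "W n = (1 - u n) ^ b * u n ^ a * real ((M - 1) choose a)"
  proof -
    have "b - 1 + a = M - 1" using ab by simp
    then show ?thesis
      unfolding W_def nbinom.w_def[OF elim(2)] by (simp add: a_def b_def M_def)
  qed
  also have "\<dots> = q n ^ a * (1 - q n) ^ b * exp (\<Psi> n) * ((1 - q n) * (S * (1 / sqrt (real M * q n * (1 - q n))) * (1 / (q n ^ a * (1 - q n) ^ b))))"
    unfolding ex C1 C2 ..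
  also have "\<dots> = (1 - q n) * S / sqrt (real M * q n * (1 - q n)) * exp (\<Psi> n)"
    using q by simp
  finally show ?case unfolding S_def a_def b_def M_def .
qed

lemma P_lim: "filterlim P at_top sequentially"
proof (rule filterlim_nat_at_top_of_real, rule filterlim_at_top_mono)
  show "filterlim (\<lambda>n. \<kappa>1 * real (N n)) at_top sequentially"
    using \<kappa> by (intro filterlim_tendsto_pos_mult_at_top[OF tendsto_const _ rN_lim]) auto
  show "\<forall>\<^sub>F n in sequentially. \<kappa>1 * real (N n) \<le> real (P n)"
    using base by eventually_elim (auto intro!: mult_right_mono)
qed

lemma N_minus_P_lim: "filterlim (\<lambda>n. N n - P n) at_top sequentially"
proof (rule filterlim_nat_at_top_of_real, rule filterlim_at_top_mono)
  show "filterlim (\<lambda>n. (1 - \<kappa>2) * real (N n)) at_top sequentially"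
    using \<kappa> by (intro filterlim_tendsto_pos_mult_at_top[OF tendsto_const _ rN_lim]) auto
  show "\<forall>\<^sub>F n in sequentially. (1 - \<kappa>2) * real (N n) \<le> real (N n - P n)"
    using base
  proof eventually_elim
    case (elim n)
    then have "q n * real (N n) \<le> \<kappa>2 * real (N n)" by (intro mult_right_mono) auto
    then show ?case using elim by (simp add: of_nat_diff algebra_simps)
  qed
qed

lemma stirling_ratio_lim:
  "(\<lambda>n. stirling_quotient (N n) / (stirling_quotient (P n) * stirling_quotient (N n - P n)))
     \<longlonglongrightarrow> 1 / sqrt (2 * pi)"
proof -
  have "(\<lambda>n. stirling_quotient (N n) / (stirling_quotient (P n) * stirling_quotient (N n - P n)))
     \<longlonglongrightarrow> sqrt (2 * pi) / (sqrt (2 * pi) * sqrt (2 * pi))"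
    by (intro tendsto_divide tendsto_mult filterlim_compose[OF stirling_quotient_tendsto] N_lim P_lim N_minus_P_lim) simp
  moreover have "x / (x * x) = 1 / x" for x :: real by simp
  ultimately show ?thesis by (simp only:)
qed

text \<open>Explains the form of \<open>s_tail\<close>: the prefactor (1 - q) / sqrt (N q (1 - q))
  equals 1 / sqrt Y, and division by (2 \<epsilon>)^2 = s^2 / Y turns it into sqrt Y / s^2.\<close>

lemma W_over_\<epsilon>_lim: "(\<lambda>n. W n / (2 * \<epsilon> n)\<^sup>2) \<longlonglongrightarrow> l"
proof -
  let ?S = "\<lambda>n. stirling_quotient (N n) / (stirling_quotient (P n) * stirling_quotient (N n - P n))"
  have "(\<lambda>n. ?S n * sqrt (2 * pi) * (sqrt (Y n) / (sqrt (2 * pi) * (s n)\<^sup>2) * exp (- (s n)\<^sup>2 / 2)) * exp (\<Psi> n + (s n)\<^sup>2 / 2))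
     \<longlonglongrightarrow> 1 / sqrt (2 * pi) * sqrt (2 * pi) * l * exp 0"
    by (intro tendsto_mult tendsto_const tendsto_exp stirling_ratio_lim s_tail \<Psi>_lim)
  moreover have "\<forall>\<^sub>F n in sequentially. ?S n * sqrt (2 * pi) * (sqrt (Y n) / (sqrt (2 * pi) * (s n)\<^sup>2) * exp (- (s n)\<^sup>2 / 2)) * exp (\<Psi> n + (s n)\<^sup>2 / 2)
     = W n / (2 * \<epsilon> n)\<^sup>2"
    using base W_eq
  proof eventually_elim
    case (elim n)
    define v where "v = ?S n"
    have q: "0 < q n" "q n < 1" and NP: "real (N n) > 0" and YP: "Y n > 0" and sP: "s n > 0" using elim by auto
    have \<epsilon>2: "(2 * \<epsilon> n)\<^sup>2 = (s n)\<^sup>2 / Y n"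
      using YP by (simp add: \<epsilon>_def power_divide power_mult_distrib)
    have rt: "sqrt (real (N n) * q n * (1 - q n)) = (1 - q n) * sqrt (Y n)"
    proof -
      have "real (N n) * q n * (1 - q n) = (1 - q n)\<^sup>2 * Y n"
        using q by (simp add: Y_def power2_eq_square)
      then show ?thesis using q by (simp add: real_sqrt_mult)
    qed
    have "W n / (2 * \<epsilon> n)\<^sup>2 = (1 - q n) * v / ((1 - q n) * sqrt (Y n)) * exp (\<Psi> n) / ((s n)\<^sup>2 / Y n)"
      unfolding \<epsilon>2 using elim by (simp add: rt v_def)
    also have "\<dots> = v * (Y n / sqrt (Y n)) / (s n)\<^sup>2 * exp (\<Psi> n)"
      using q YP sP by (simp add: field_simps)
    also have "Y n / sqrt (Y n) = sqrt (Y n)" using YP by (simp add: real_div_sqrt)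
    finally have *: "W n / (2 * \<epsilon> n)\<^sup>2 = v * sqrt (Y n) / (s n)\<^sup>2 * exp (\<Psi> n)" .
    have "exp (- (s n)\<^sup>2 / 2) * exp (\<Psi> n + (s n)\<^sup>2 / 2) = exp (\<Psi> n)"
      by (simp add: exp_add[symmetric])
    then have "v * sqrt (2 * pi) * (sqrt (Y n) / (sqrt (2 * pi) * (s n)\<^sup>2) * exp (- (s n)\<^sup>2 / 2)) * exp (\<Psi> n + (s n)\<^sup>2 / 2)
      = v * sqrt (2 * pi) * (sqrt (Y n) / (sqrt (2 * pi) * (s n)\<^sup>2)) * exp (\<Psi> n)"
      by (simp only: mult.assoc)
    also have "\<dots> = v * sqrt (Y n) / (s n)\<^sup>2 * exp (\<Psi> n)" by simp
    finally show ?case using * by (simp add: v_def)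
  qed
  ultimately show ?thesis by (rule tendsto_eventually_eq) simp
qed

lemma r_eq: "\<forall>\<^sub>F n in sequentially. \<forall>k\<le>P n. r n k = real (P n - k) / ((real (N n) - 1 - real k) * u n)"
  using nbinom base
proof eventually_elim
  case (elim n)
  show ?case
  proof (intro allI impI)
    fix k assume "k \<le> P n"
    then have "real (N n - P n - 1 + (P n - k)) = real (N n) - 1 - real k"
      using elim by (simp add: of_nat_diff)
    then show "r n k = real (P n - k) / ((real (N n) - 1 - real k) * u n)"
      unfolding r_def nbinom.\<rho>_def[OF elim(1)] by simp
  qed
qed

text \<open>Apart from a factor N / (N - 1), \<open>r n 0\<close> is q / u = 1 / (1 + \<epsilon>)^2,
  whose distance from 1 is about 2 \<epsilon>. The extra factor costs order 1 / N, negligible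
  against \<epsilon>.\<close>

lemma \<delta>_over_\<epsilon>_lim: "(\<lambda>n. (1 - r n 0) / (2 * \<epsilon> n)) \<longlonglongrightarrow> 1"
proof -
  have "(\<lambda>n. (1 + \<epsilon> n / 2 - 1 / (\<epsilon> n * real (N n)) / (2 * (1 - 1 / real (N n)))) / (1 + \<epsilon> n)\<^sup>2)
      \<longlonglongrightarrow> (1 + 0 / 2 - 0 / (2 * (1 - 0))) / (1 + 0)\<^sup>2"
    by (intro tendsto_intros \<epsilon>_lim inverse_\<epsilon>_N_lim inverse_N_lim) auto
  moreover have "\<forall>\<^sub>F n in sequentially. (1 + \<epsilon> n / 2 - 1 / (\<epsilon> n * real (N n)) / (2 * (1 - 1 / real (N n)))) / (1 + \<epsilon> n)\<^sup>2
     = (1 - r n 0) / (2 * \<epsilon> n)"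
    using base r_eq
  proof eventually_elim
    case (elim n)
    define M e where "M = real (N n)" and "e = \<epsilon> n"
    have M: "M \<ge> 2" and e: "e > 0" and q: "q n > 0" using elim by (auto simp: M_def e_def)
    have "r n 0 = (q n * M) / ((M - 1) * (q n * (1 + e)\<^sup>2))"
      using elim(2) elim(1) by (simp add: M_def e_def u_def)
    also have "\<dots> = M / ((M - 1) * (1 + e)\<^sup>2)" using q by simp
    finally have r0: "r n 0 = M / ((M - 1) * (1 + e)\<^sup>2)" .
    have "(1 + e)\<^sup>2 - M / (M - 1) = 2 * e + e\<^sup>2 - 1 / (M - 1)"
      using M by (simp add: field_simps power2_eq_square)
    moreover have "1 - r n 0 = ((1 + e)\<^sup>2 - M / (M - 1)) / (1 + e)\<^sup>2"
      unfolding r0 using e by (simp add: diff_divide_distrib)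
    ultimately have "(1 - r n 0) / (2 * e) = (2 * e + e\<^sup>2 - 1 / (M - 1)) / (2 * e) / (1 + e)\<^sup>2"
      by simp
    also have "(2 * e + e\<^sup>2 - 1 / (M - 1)) / (2 * e) = 1 + e / 2 - 1 / (M - 1) / (2 * e)"
      using e by (simp add: add_divide_distrib diff_divide_distrib power2_eq_square)
    also have "1 / (M - 1) / (2 * e) = 1 / (e * M) / (2 * (1 - 1 / M))"
      using M e by (simp add: field_simps)
    finally show ?case by (simp add: M_def e_def)
  qed
  ultimately show ?thesis by (rule tendsto_eventually_eq) simp
qed

lemma W_over_\<delta>_lim: "(\<lambda>n. W n / (1 - r n 0)\<^sup>2) \<longlonglongrightarrow> l"
proof -
  have "(\<lambda>n. (W n / (2 * \<epsilon> n)\<^sup>2) / ((1 - r n 0) / (2 * \<epsilon> n))\<^sup>2) \<longlonglongrightarrow> l / 1\<^sup>2"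
    by (intro tendsto_intros W_over_\<epsilon>_lim \<delta>_over_\<epsilon>_lim) auto
  moreover have "\<forall>\<^sub>F n in sequentially. (W n / (2 * \<epsilon> n)\<^sup>2) / ((1 - r n 0) / (2 * \<epsilon> n))\<^sup>2 = W n / (1 - r n 0)\<^sup>2"
    using base by eventually_elim (simp add: power_divide)
  ultimately show ?thesis by (rule tendsto_eventually_eq) simp
qed

lemma \<delta>_pos: "\<forall>\<^sub>F n in sequentially. r n 0 < 1"
proof -
  have "\<forall>\<^sub>F n in sequentially. 0 < (1 - r n 0) / (2 * \<epsilon> n)"
    using \<delta>_over_\<epsilon>_lim by (rule order_tendstoD) simp
  with base show ?thesis by eventually_elim (simp add: zero_less_divide_iff)
qed

lemma \<delta>_lim: "(\<lambda>n. 1 - r n 0) \<longlonglongrightarrow> 0"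
proof -
  have "(\<lambda>n. (1 - r n 0) / (2 * \<epsilon> n) * (2 * \<epsilon> n)) \<longlonglongrightarrow> 1 * (2 * 0)"
    by (intro tendsto_mult tendsto_const \<delta>_over_\<epsilon>_lim \<epsilon>_lim)
  moreover have "\<forall>\<^sub>F n in sequentially. (1 - r n 0) / (2 * \<epsilon> n) * (2 * \<epsilon> n) = 1 - r n 0"
    using base by eventually_elim simp
  ultimately show ?thesis by (rule tendsto_eventually_eq) simp
qed

text \<open>A cut-off that is large compared with \<open>1 / (1 - r n 0)\<close>, yet so small that the ratio \<open>r n k\<close>
  stays essentially constant for \<open>k \<le> K n\<close>.\<close>

definition K :: "nat \<Rightarrow> nat" where "K n = nat \<lfloor>sqrt (real (N n))\<rfloor>"

lemma K_bounds: "real (K n) \<le> sqrt (real (N n))" "sqrt (real (N n)) \<le> real (Suc (K n))"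
proof -
  show "real (K n) \<le> sqrt (real (N n))" unfolding K_def by (simp add: of_nat_floor)
  show "sqrt (real (N n)) \<le> real (Suc (K n))" unfolding K_def by linarith
qed

lemma sqrt_N_ratio_lim: "(\<lambda>n. sqrt (real (N n)) / real (N n)) \<longlonglongrightarrow> 0"
proof -
  have "((\<lambda>x. sqrt x / x) \<longlongrightarrow> 0) at_top" by real_asymp
  then show ?thesis by (rule filterlim_compose) (rule rN_lim)
qed

lemma K_less: "\<forall>\<^sub>F n in sequentially. K n < P n"
proof -
  have "\<forall>\<^sub>F n in sequentially. sqrt (real (N n)) / real (N n) < \<kappa>1"
    using sqrt_N_ratio_lim \<kappa> by (intro order_tendstoD) auto
  with base show ?thesis
  proof eventually_elim
    case (elim n)
    then have "sqrt (real (N n)) < \<kappa>1 * real (N n)" by (simp add: divide_simps)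
    also have "\<dots> \<le> real (P n)" using elim by (auto intro!: mult_right_mono)
    finally show ?case using K_bounds(1)[of n] by linarith
  qed
qed

text \<open>The ratio moves by order 1 / N per index, so by order 1 / sqrt N up to the cut-off, and
  this is small compared with \<epsilon>.\<close>

lemma \<delta>K_ratio_lim: "(\<lambda>n. (1 - r n (K n)) / (1 - r n 0)) \<longlonglongrightarrow> 1"
proof -
  \<comment> \<open>Eventually equal to sqrt N / (N - 1 - sqrt N) / \<kappa>1 / (1 -
    \<open>r n 0\<close>), arranged as a product of factors with known limits.\<close>
  define z where "z n = 1 / \<kappa>1 * (1 / (\<epsilon> n * sqrt (real (N n)))) * (1 / (1 - 1 / real (N n) - sqrt (real (N n)) / real (N n))) * (1 / ((1 - r n 0) / (2 * \<epsilon> n)) / 2)" for n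
  have "z \<longlonglongrightarrow> 1 / \<kappa>1 * 0 * (1 / (1 - 0 - 0)) * (1 / 1 / 2)"
    unfolding z_def
    by (intro tendsto_intros inverse_\<epsilon>_sqrt_N_lim inverse_N_lim sqrt_N_ratio_lim \<delta>_over_\<epsilon>_lim) auto
  then have z: "z \<longlonglongrightarrow> 0" by simp
  have small: "\<forall>\<^sub>F n in sequentially. 0 < 1 - 1 / real (N n) - sqrt (real (N n)) / real (N n)"
  proof -
    have "(\<lambda>n. 1 - 1 / real (N n) - sqrt (real (N n)) / real (N n)) \<longlonglongrightarrow> 1 - 0 - 0"
      by (intro tendsto_intros inverse_N_lim sqrt_N_ratio_lim)
    then show ?thesis by (intro order_tendstoD) auto
  qed
  have bound: "\<forall>\<^sub>F n in sequentially. 1 \<le> (1 - r n (K n)) / (1 - r n 0) \<and> (1 - r n (K n)) / (1 - r n 0) \<le> 1 + z n"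
    using base nbinom r_eq K_less \<delta>_pos small u_bounds
  proof eventually_elim
    case (elim n)
    define M k \<delta> where "M = real (N n)" and "k = real (K n)" and "\<delta> = 1 - r n 0"
    have \<delta>: "\<delta> > 0" and u: "u n \<ge> \<kappa>1" "u n > 0" and M: "M \<ge> 2" and e: "\<epsilon> n > 0"
      using elim by (auto simp: \<delta>_def M_def)
    have k: "0 \<le> k" "k \<le> sqrt M" using K_bounds(1)[of n] by (auto simp: k_def M_def)
    have d: "M - 1 - sqrt M > 0"
    proof -
      have "0 < M * (1 - 1 / M - sqrt M / M)" using elim M unfolding M_def by (intro mult_pos_pos) auto
      then show ?thesis using M by (simp add: algebra_simps)
    qed
    have PM: "real (P n) \<le> M - 1" using elim by (simp add: M_def)
    have r0: "r n 0 = real (P n) / ((M - 1) * u n)"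
      using elim(3) by (simp add: M_def)
    have rK: "r n (K n) = (real (P n) - k) / ((M - 1 - k) * u n)"
      using elim(3,4) by (simp add: M_def k_def of_nat_diff)
    have diff: "real (P n) / (M - 1) - (real (P n) - k) / (M - 1 - k) = k * (M - 1 - real (P n)) / ((M - 1) * (M - 1 - k))"
      using d k M by (simp add: field_simps)
    have "r n 0 - r n (K n) = (real (P n) / (M - 1) - (real (P n) - k) / (M - 1 - k)) / u n"
      unfolding r0 rK by (simp add: diff_divide_distrib)
    also have "\<dots> \<le> (k / (M - 1 - k)) / u n"
    proof (rule divide_right_mono)
      have "k * (M - 1 - real (P n)) / ((M - 1) * (M - 1 - k)) \<le> k * (M - 1) / ((M - 1) * (M - 1 - k))"
        using k d M by (intro divide_right_mono mult_left_mono mult_nonneg_nonneg) auto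
      also have "\<dots> = k / (M - 1 - k)" using M by simp
      finally show "real (P n) / (M - 1) - (real (P n) - k) / (M - 1 - k) \<le> k / (M - 1 - k)" unfolding diff .
    qed (use u in auto)
    also have "\<dots> \<le> (sqrt M / (M - 1 - sqrt M)) / \<kappa>1"
      using k d u \<kappa> M by (intro frac_le divide_nonneg_nonneg) auto
    finally have up: "r n 0 - r n (K n) \<le> sqrt M / (M - 1 - sqrt M) / \<kappa>1" .
    have low: "r n (K n) \<le> r n 0"
      unfolding r_def using elim by (intro nbinom.\<rho>_antimono) auto
    have "(1 - r n (K n)) / \<delta> = 1 + (r n 0 - r n (K n)) / \<delta>"
      using \<delta> by (simp add: \<delta>_def field_simps)
    moreover have "0 \<le> (r n 0 - r n (K n)) / \<delta>" using low \<delta> by simp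
    moreover have "(r n 0 - r n (K n)) / \<delta> \<le> sqrt M / (M - 1 - sqrt M) / \<kappa>1 / \<delta>"
      using up \<delta> by (intro divide_right_mono) auto
    moreover have "sqrt M / (M - 1 - sqrt M) / \<kappa>1 / \<delta> = z n"
    proof -
      have "sqrt M / (M - 1 - sqrt M) = 1 / sqrt M * (1 / (1 - 1 / M - sqrt M / M))"
      proof -
        have "1 - 1 / M - sqrt M / M = (M - 1 - sqrt M) / M" using M by (simp add: field_simps)
        then show ?thesis using M by (simp add: real_div_sqrt)
      qed
      then show ?thesis
        unfolding z_def \<delta>_def[symmetric] M_def[symmetric] using e \<delta> by simp
    qed
    ultimately show ?case by (simp add: \<delta>_def)
  qed
  show ?thesis
  proof (rule tendsto_sandwich)
    show "\<forall>\<^sub>F n in sequentially. 1 \<le> (1 - r n (K n)) / (1 - r n 0)"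
      "\<forall>\<^sub>F n in sequentially. (1 - r n (K n)) / (1 - r n 0) \<le> 1 + z n"
      using bound by (auto elim: eventually_mono)
    show "(\<lambda>n. 1 + z n) \<longlonglongrightarrow> 1" using tendsto_add[OF tendsto_const z, of 1] by simp
  qed simp
qed

lemma K_\<delta>K_lim: "filterlim (\<lambda>n. real (Suc (K n)) * (1 - r n (K n))) at_top sequentially"
proof (rule filterlim_at_top_mono)
  have "filterlim (\<lambda>n. inverse (1 / (\<epsilon> n * sqrt (real (N n))))) at_top sequentially"
    using base by (intro filterlim_inverse_at_top inverse_\<epsilon>_sqrt_N_lim) (auto elim!: eventually_mono)
  then have "filterlim (\<lambda>n. 2 * ((1 - r n 0) / (2 * \<epsilon> n)) * inverse (1 / (\<epsilon> n * sqrt (real (N n))))) at_top sequentially"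
    by (intro filterlim_tendsto_pos_mult_at_top[where c = "2 * 1"] tendsto_mult tendsto_const \<delta>_over_\<epsilon>_lim) auto
  moreover have "\<forall>\<^sub>F n in sequentially. 2 * ((1 - r n 0) / (2 * \<epsilon> n)) * inverse (1 / (\<epsilon> n * sqrt (real (N n)))) = sqrt (real (N n)) * (1 - r n 0)"
    using base by eventually_elim simp
  ultimately show "filterlim (\<lambda>n. sqrt (real (N n)) * (1 - r n 0)) at_top sequentially"
    by (rule filterlim_cong[OF refl refl, THEN iffD1, rotated])
  show "\<forall>\<^sub>F n in sequentially. sqrt (real (N n)) * (1 - r n 0) \<le> real (Suc (K n)) * (1 - r n (K n))"
    using nbinom K_less \<delta>_pos
  proof eventually_elim
    case (elim n)
    have "r n (K n) \<le> r n 0"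
      unfolding r_def using elim by (intro nbinom.\<rho>_antimono) auto
    then show ?case using K_bounds(2)[of n] elim by (intro mult_mono) auto
  qed
qed

lemma sum_nbinom_cdf_lim:
  "(\<lambda>n. \<Sum>k\<le>P n. nbinom_cdf (N n - P n) k (u n)) \<longlonglongrightarrow> l"
proof (rule tendsto_sandwich)
  show "\<forall>\<^sub>F n in sequentially. (\<Sum>k\<le>P n. nbinom_cdf (N n - P n) k (u n)) \<le> W n / (1 - r n 0)\<^sup>2"
    using nbinom \<delta>_pos unfolding W_def r_def by eventually_elim (rule nbinom.sum_cdf_upper)
  let ?x = "\<lambda>n. real (Suc (K n)) * (1 - r n (K n))"
  show "\<forall>\<^sub>F n in sequentially. W n / (1 - r n (K n))\<^sup>2 * (1 - (1 + ?x n) * exp (- ?x n))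
      \<le> (\<Sum>k\<le>P n. nbinom_cdf (N n - P n) k (u n))"
    using nbinom \<delta>_pos K_less unfolding W_def r_def by eventually_elim (rule nbinom.sum_cdf_lower)
  show "(\<lambda>n. W n / (1 - r n 0)\<^sup>2) \<longlonglongrightarrow> l" by (rule W_over_\<delta>_lim)
  have "((\<lambda>x::real. (1 + x) * exp (- x)) \<longlongrightarrow> 0) at_top" by real_asymp
  then have "(\<lambda>n. (1 + ?x n) * exp (- ?x n)) \<longlonglongrightarrow> 0"
    by (rule filterlim_compose[OF _ K_\<delta>K_lim])
  then have "(\<lambda>n. W n / (1 - r n 0)\<^sup>2 / ((1 - r n (K n)) / (1 - r n 0))\<^sup>2 * (1 - (1 + ?x n) * exp (- ?x n))) \<longlonglongrightarrow> l / 1\<^sup>2 * (1 - 0)"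
    by (intro tendsto_mult tendsto_divide tendsto_power tendsto_diff tendsto_const W_over_\<delta>_lim \<delta>K_ratio_lim) auto
  moreover have "\<forall>\<^sub>F n in sequentially. W n / (1 - r n 0)\<^sup>2 / ((1 - r n (K n)) / (1 - r n 0))\<^sup>2 * (1 - (1 + ?x n) * exp (- ?x n))
      = W n / (1 - r n (K n))\<^sup>2 * (1 - (1 + ?x n) * exp (- ?x n))"
    using \<delta>_pos by eventually_elim (simp add: power_divide)
  ultimately show "(\<lambda>n. W n / (1 - r n (K n))\<^sup>2 * (1 - (1 + ?x n) * exp (- ?x n))) \<longlonglongrightarrow> l"
    by (rule tendsto_eventually_eq) simp
qed

lemma prod_nbinom_cdf_lim:
  "(\<lambda>n. \<Prod>k\<le>P n. 1 - nbinom_cdf (N n - P n) k (u n)) \<longlonglongrightarrow> exp (- l)"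
proof (rule prod_one_minus_tendsto_exp)
  show "\<forall>\<^sub>F n in sequentially. \<forall>k\<in>{..P n}. 0 \<le> nbinom_cdf (N n - P n) k (u n) \<and>
      nbinom_cdf (N n - P n) k (u n) \<le> W n / (1 - r n 0)"
    using nbinom \<delta>_pos
  proof eventually_elim
    case (elim n)
    show ?case
    proof (intro ballI conjI)
      fix k assume "k \<in> {..P n}"
      show "0 \<le> nbinom_cdf (N n - P n) k (u n)" by (rule nbinom.cdf_nonneg[OF elim(1)])
      have "nbinom_cdf (N n - P n) k (u n) \<le> nbinom_cdf (N n - P n) (P n) (u n)"
        using \<open>k \<in> {..P n}\<close> by (intro nbinom.cdf_mono[OF elim(1)]) auto
      also have "\<dots> \<le> W n / (1 - r n 0)"
        using elim(2) unfolding W_def r_def by (rule nbinom.cdf_upper[OF elim(1)])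
      finally show "nbinom_cdf (N n - P n) k (u n) \<le> W n / (1 - r n 0)" .
    qed
  qed
  have "(\<lambda>n. W n / (1 - r n 0)\<^sup>2 * (1 - r n 0)) \<longlonglongrightarrow> l * 0"
    by (intro tendsto_mult W_over_\<delta>_lim \<delta>_lim)
  moreover have "\<forall>\<^sub>F n in sequentially. W n / (1 - r n 0)\<^sup>2 * (1 - r n 0) = W n / (1 - r n 0)"
    using \<delta>_pos by eventually_elim (simp add: power2_eq_square)
  ultimately show "(\<lambda>n. W n / (1 - r n 0)) \<longlonglongrightarrow> 0"
    by (rule tendsto_eventually_eq) simp
qed (rule sum_nbinom_cdf_lim)

end

section \<open>Weak convergence of the normalised maximum\<close>

lemma gumbel_distribution:
  "real_distribution (interval_measure gumbel_cdf)" "cdf (interval_measure gumbel_cdf) = gumbel_cdf"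
proof -
  have mono: "gumbel_cdf x \<le> gumbel_cdf y" if "x \<le> y" for x y
    using that by (simp add: gumbel_cdf_def)
  have cont: "continuous (at_right a) gumbel_cdf" for a
    unfolding gumbel_cdf_def by (intro continuous_intros)
  have bot: "(gumbel_cdf \<longlongrightarrow> 0) at_bot" unfolding gumbel_cdf_def by real_asymp
  have top: "(gumbel_cdf \<longlongrightarrow> 1) at_top" unfolding gumbel_cdf_def by real_asymp
  show "real_distribution (interval_measure gumbel_cdf)"
    by (rule real_distribution_interval_measure[OF mono cont bot top])
  show "cdf (interval_measure gumbel_cdf) = gumbel_cdf"
    by (rule cdf_interval_measure[OF mono cont bot])
qed

lemma cdf_normalized_max:
  fixes Z :: "nat \<Rightarrow> 'a \<Rightarrow> complex"
  assumes "prob_space M" "p \<ge> 1" "B > 0"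
    and meas: "(\<lambda>\<omega>. \<lambda>j\<in>{1..p}. Z j \<omega>) \<in> measurable M (\<Pi>\<^sub>M j\<in>{1..p}. (lborel :: complex measure))"
  shows "cdf (distr M borel (\<lambda>\<omega>. ((MAX j\<in>{1..p}. cmod (Z j \<omega>)) - A) / B)) t =
    measure M {\<omega> \<in> space M. \<forall>j\<in>{1..p}. cmod (Z j \<omega>) \<le> A + B * t}"
proof -
  have Z [measurable]: "Z j \<in> borel_measurable M" if "j \<in> {1..p}" for j
  proof -
    have "(\<lambda>\<omega>. (\<lambda>j\<in>{1..p}. Z j \<omega>) j) \<in> measurable M lborel"
      using measurable_compose[OF meas measurable_component_singleton[OF that]] .
    then show ?thesis using that by simp
  qed
  have "(\<lambda>\<omega>. MAX j\<in>{1..p}. cmod (Z j \<omega>)) \<in> borel_measurable M"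
    by (intro borel_measurable_Max) auto
  then have [measurable]: "(\<lambda>\<omega>. ((MAX j\<in>{1..p}. cmod (Z j \<omega>)) - A) / B) \<in> borel_measurable M"
    by measurable
  have "((MAX j\<in>{1..p}. cmod (Z j \<omega>)) - A) / B \<le> t \<longleftrightarrow> (\<forall>j\<in>{1..p}. cmod (Z j \<omega>) \<le> A + B * t)" for \<omega>
  proof -
    have "((MAX j\<in>{1..p}. cmod (Z j \<omega>)) - A) / B \<le> t \<longleftrightarrow> (MAX j\<in>{1..p}. cmod (Z j \<omega>)) \<le> A + B * t"
      using \<open>B > 0\<close> by (simp add: field_simps)
    also have "\<dots> \<longleftrightarrow> (\<forall>j\<in>{1..p}. cmod (Z j \<omega>) \<le> A + B * t)"
      using \<open>p \<ge> 1\<close> by (subst Max_le_iff) auto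
    finally show ?thesis .
  qed
  then have "(\<lambda>\<omega>. ((MAX j\<in>{1..p}. cmod (Z j \<omega>)) - A) / B) -` {..t} \<inter> space M
      = {\<omega> \<in> space M. \<forall>j\<in>{1..p}. cmod (Z j \<omega>) \<le> A + B * t}"
    by auto
  then show ?thesis
    unfolding cdf_def by (subst measure_distr) auto
qed

theorem theorem2:
  fixes p :: "nat \<Rightarrow> nat" and h1 h2 :: real
    and M :: "nat \<Rightarrow> 'a measure"
    and Z :: "nat \<Rightarrow> nat \<Rightarrow> 'a \<Rightarrow> complex"
    and C :: "nat \<Rightarrow> real"
  assumes p_bounds: "\<And>n. n \<ge> 2 \<Longrightarrow> n > p n \<and> p n \<ge> 1"
    and h1: "0 < h1" "h1 < 1"
    and h2: "0 < h2" "h2 < 1"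
    and ratio: "\<And>n. n \<ge> 2 \<Longrightarrow> h1 < real (p n) / real n \<and> real (p n) / real n < h2"
    and prob: "\<And>n. n \<ge> 2 \<Longrightarrow> prob_space (M n)"
    and density: "\<And>n. n \<ge> 2 \<Longrightarrow>
      distributed (M n) (\<Pi>\<^sub>M j\<in>{1..p n}. (lborel :: complex measure))
        (\<lambda>\<omega>. \<lambda>j\<in>{1..p n}. Z n j \<omega>)
        (\<lambda>z. ennreal (truncated_unitary_density n (p n) (C n) z))"
  shows "converges_weakly_to_cdf M
    (\<lambda>n \<omega>. ((MAX j\<in>{1..p n}. cmod (Z n j \<omega>)) - A_seq p n) / B_seq p n) gumbel_cdf"
proof -
  define N P where "N n = n - 1" and "P n = p n - 1" for n
  define q where "q n = real (P n) / real (N n)" for n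
  define Y where "Y n = real (N n) * q n / (1 - q n)" for n
  \<comment> \<open>The norming sequences are evaluated at \<open>y\<close>, built with n, whereas
    the local expansion produces \<open>Y\<close>, built with n - 1. Their quotient tends to 1,
    which carries the limits over.\<close>
  define y where "y n = real n * q n / (1 - q n)" for n
  have N_lim: "filterlim N at_top sequentially"
    unfolding N_def by (rule filterlim_minus_const_nat_at_top)
  have ev2: "\<forall>\<^sub>F n in sequentially. 2 \<le> n" by (rule eventually_ge_at_top)
  \<comment> \<open>Passing from p / n to (p - 1) / (n - 1) keeps the upper bound, as h2 < 1, and
    costs half of the lower one, as soon as h1 * n \<ge> 2.\<close>
  have q_bounds: "\<forall>\<^sub>F n in sequentially. h1 / 2 \<le> q n \<and> q n \<le> h2"
  proof -
    have "\<forall>\<^sub>F n in sequentially. 2 / h1 \<le> real n"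
      using filterlim_real_sequentially by (simp add: filterlim_at_top)
    with ev2 show ?thesis
    proof eventually_elim
      case (elim n)
      have p: "p n < n" "1 \<le> p n" "h1 * real n < real (p n)" "real (p n) < h2 * real n"
        using p_bounds[of n] ratio[of n] elim by (auto simp: field_simps)
      have N: "real (N n) = real n - 1" and P: "real (P n) = real (p n) - 1"
        using elim p by (auto simp: N_def P_def of_nat_diff)
      have "2 \<le> h1 * real n" using elim h1 by (simp add: field_simps)
      moreover have "h1 / 2 * (real n - 1) = h1 * real n / 2 - h1 / 2" by (simp add: right_diff_distrib)
      ultimately have "h1 / 2 * (real n - 1) \<le> real (p n) - 1"
        using p h1 by linarith
      moreover have "real (p n) - 1 \<le> h2 * (real n - 1)"
        using p h2 by (simp add: algebra_simps)
      ultimately show ?case using elim by (simp add: q_def N P field_simps)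
    qed
  qed
  have y_lim: "filterlim y at_top sequentially"
  proof (rule filterlim_at_top_mono)
    show "filterlim (\<lambda>n. h1 / 2 * real n) at_top sequentially"
      using h1 by (intro filterlim_tendsto_pos_mult_at_top[OF tendsto_const _ filterlim_real_sequentially]) auto
    show "\<forall>\<^sub>F n in sequentially. h1 / 2 * real n \<le> y n"
      using q_bounds
    proof eventually_elim
      case (elim n)
      have q: "0 \<le> q n" "q n < 1" using elim h1 h2 by auto
      have "h1 / 2 * real n \<le> q n * real n" using elim by (intro mult_right_mono) auto
      also have "\<dots> \<le> y n"
        using q mult_left_mono[of "1 - q n" 1 "q n * real n"] by (simp add: y_def field_simps)
      finally show ?case .
    qed
  qed
  have yY: "(\<lambda>n. sqrt (real n / real (N n))) \<longlonglongrightarrow> 1"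
  proof -
    have "(\<lambda>n. sqrt (real n / (real n - 1))) \<longlonglongrightarrow> 1" by real_asymp
    moreover have "\<forall>\<^sub>F n in sequentially. sqrt (real n / (real n - 1)) = sqrt (real n / real (N n))"
      using ev2 by eventually_elim (simp add: N_def of_nat_diff)
    ultimately show ?thesis by (rule tendsto_eventually_eq) simp
  qed
  have ev: "\<forall>\<^sub>F n in sequentially. 2 \<le> n \<and> 0 < q n \<and> q n < 1 \<and> 1 < y n \<and> 0 < Y n \<and>
      sqrt (y n) = sqrt (Y n) * sqrt (real n / real (N n)) \<and> 0 < N n"
  proof -
    have "\<forall>\<^sub>F n in sequentially. 1 < y n" using y_lim by (simp add: filterlim_at_top_dense)
    with ev2 q_bounds show ?thesis
    proof eventually_elim
      case (elim n)
      then have "0 < q n" "q n < 1" "N n > 0" using h1 h2 by (auto simp: N_def)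
      then show ?case using elim
        by (auto simp: Y_def y_def simp flip: real_sqrt_mult)
    qed
  qed
  have main: "(\<lambda>n. cdf (distr (M n) borel (\<lambda>\<omega>. ((MAX j\<in>{1..p n}. cmod (Z n j \<omega>)) - A_seq p n) / B_seq p n)) t)
      \<longlonglongrightarrow> gumbel_cdf t" for t
  proof -
    define s where "s n = gumbel_point t (y n)" for n
    have s_lim: "filterlim s at_top sequentially"
      unfolding s_def by (rule filterlim_compose[OF gumbel_point_at_top y_lim])
    have s_cube: "(\<lambda>n. s n ^ 3 / sqrt (Y n)) \<longlonglongrightarrow> 0"
    proof (rule tendsto_eventually_eq)
      show "(\<lambda>n. s n ^ 3 / sqrt (y n) * sqrt (real n / real (N n))) \<longlonglongrightarrow> 0 * 1"
        unfolding s_def by (intro tendsto_mult yY filterlim_compose[OF gumbel_point_cube y_lim])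
      show "\<forall>\<^sub>F n in sequentially. s n ^ 3 / sqrt (y n) * sqrt (real n / real (N n)) = s n ^ 3 / sqrt (Y n)"
        using ev by eventually_elim simp
    qed simp
    have s_tail: "(\<lambda>n. sqrt (Y n) / (sqrt (2 * pi) * (s n)\<^sup>2) * exp (- (s n)\<^sup>2 / 2)) \<longlonglongrightarrow> exp (- t)"
    proof (rule tendsto_eventually_eq)
      show "(\<lambda>n. sqrt (y n) / (sqrt (2 * pi) * (s n)\<^sup>2) * exp (- (s n)\<^sup>2 / 2) / sqrt (real n / real (N n))) \<longlonglongrightarrow> exp (- t) / 1"
        unfolding s_def by (intro tendsto_divide yY filterlim_compose[OF gumbel_point_tail y_lim]) simp
      show "\<forall>\<^sub>F n in sequentially. sqrt (y n) / (sqrt (2 * pi) * (s n)\<^sup>2) * exp (- (s n)\<^sup>2 / 2) / sqrt (real n / real (N n))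
          = sqrt (Y n) / (sqrt (2 * pi) * (s n)\<^sup>2) * exp (- (s n)\<^sup>2 / 2)"
        using ev by eventually_elim simp
    qed simp
    interpret nbinom_asymp N P s "exp (- t)" "h1 / 2" h2 q Y "\<lambda>n. s n / (2 * sqrt (Y n))"
      "\<lambda>n. q n * (1 + s n / (2 * sqrt (Y n)))\<^sup>2"
      using h1 h2 N_lim q_bounds[unfolded q_def] s_lim s_cube[unfolded Y_def q_def] s_tail[unfolded Y_def q_def]
      by unfold_locales (simp_all add: q_def Y_def fun_eq_iff atomize_eq)
    have "\<forall>\<^sub>F n in sequentially. (\<Prod>k\<le>P n. 1 - nbinom_cdf (N n - P n) k (q n * (1 + s n / (2 * sqrt (Y n)))\<^sup>2))
       = cdf (distr (M n) borel (\<lambda>\<omega>. ((MAX j\<in>{1..p n}. cmod (Z n j \<omega>)) - A_seq p n) / B_seq p n)) t"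
      using ev u_bounds base
    proof eventually_elim
      case (elim n)
      have n: "2 \<le> n" and p: "p n < n" "1 \<le> p n" using elim p_bounds by auto
      have q: "0 < q n" "q n < 1" using elim by auto
      have N: "real (N n) = real n - 1" and P: "real (P n) = real (p n) - 1"
        using n p by (auto simp: N_def P_def of_nat_diff)
      have NP: "N n - P n = n - p n" using n p by (simp add: N_def P_def)
      have c: "c_seq p n = sqrt (q n)" by (simp add: c_seq_def q_def N P)
      have c2: "(c_seq p n)\<^sup>2 = q n" using q by (simp add: c)
      have yn: "real n * (c_seq p n)\<^sup>2 / (1 - (c_seq p n)\<^sup>2) = y n" by (simp add: c2 y_def)
      have s: "s n = a_seq p n + b_seq p n * t"
        unfolding a_seq_def b_seq_def yn by (simp add: s_def gumbel_point_def norm_a_def norm_b_def)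
      define D where "D = 1/2 * sqrt (1 - q n) * (real n - 1) powr (-1/2)"
      have D: "D = sqrt (1 - q n) / (2 * sqrt (real (N n)))"
        using n by (simp add: D_def N powr_minus_divide powr_half_sqrt)
      have B: "B_seq p n = D * b_seq p n" and A: "A_seq p n = sqrt (q n) + D * a_seq p n"
        unfolding B_seq_def A_seq_def c2 D_def by (simp_all add: c)
      have "b_seq p n > 0" unfolding b_seq_def yn norm_b_def using elim by simp
      moreover have "D > 0" unfolding D using q n N by simp
      ultimately have B_pos: "B_seq p n > 0" by (simp add: B)
      define x where "x = A_seq p n + B_seq p n * t"
      have "x = sqrt (q n) + D * s n"
        unfolding x_def A B s by (simp add: algebra_simps)
      \<comment> \<open>Since Y = N q / (1 - q), the scale \<open>D\<close> is sqrt q / (2 sqrt Y).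
        This makes the deviation from c_n a relative one, of size \<epsilon>.\<close>
      also have "D * s n = sqrt (q n) * (s n / (2 * sqrt (Y n)))"
        using q n N unfolding D Y_def by (simp add: real_sqrt_mult real_sqrt_divide field_simps)
      finally have x: "x = sqrt (q n) * (1 + s n / (2 * sqrt (Y n)))" by (simp add: algebra_simps)
      then have x2: "x\<^sup>2 = q n * (1 + s n / (2 * sqrt (Y n)))\<^sup>2"
        using q by (simp add: power_mult_distrib)
      \<comment> \<open>The product formula covers only thresholds in [0, 1]; the threshold lies
        there eventually because its square is the \<open>u n\<close> of the locale.\<close>
      have x_bounds: "0 \<le> x" "x \<le> 1"
      proof -
        show "0 \<le> x" unfolding x using q elim by (intro mult_nonneg_nonneg) auto
        have "x\<^sup>2 \<le> 1" unfolding x2 using elim by auto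
        then show "x \<le> 1" by (simp add: abs_square_le_1)
      qed
      have "cdf (distr (M n) borel (\<lambda>\<omega>. ((MAX j\<in>{1..p n}. cmod (Z n j \<omega>)) - A_seq p n) / B_seq p n)) t
          = measure (M n) {\<omega> \<in> space (M n). \<forall>j\<in>{1..p n}. cmod (Z n j \<omega>) \<le> x}"
        unfolding x_def
        by (rule cdf_normalized_max[OF prob[OF n] p(2) B_pos distributed_measurable[OF density[OF n]]])
      also have "\<dots> = (\<Prod>k<p n. 1 - nbinom_cdf (n - p n) k (x\<^sup>2))"
        by (rule max_modulus_distribution[OF prob[OF n] p(1) x_bounds density[OF n]])
      also have "{..<p n} = {..P n}" using p by (auto simp: P_def)
      finally show ?case by (simp add: NP x2)
    qed
    from tendsto_eventually_eq[OF prod_nbinom_cdf_lim this] show ?thesis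
      by (simp add: gumbel_cdf_def)
  qed
  show ?thesis
    unfolding converges_weakly_to_cdf_def weak_conv_m_def weak_conv_def
    using gumbel_distribution main by (intro exI[of _ "interval_measure gumbel_cdf"]) auto
qed

end
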